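(* Let $D\ge 2$, $\theta\in\mathbb R$, and let $J^-=J^-_D$ be the $D$-dimensional representation of the lowering operator of $\mathfrak{su}(2)$. Consider the phase cMPU ansatz $$U_\theta=\mathrm{Tr}\Big(B\,\mathcal P e^{\int_I dx\,(Q(x)\otimes \mathrm{Id}+T(x)\otimes \mathrm{Ad}_x)}\Big)\big(|\Omega\rangle\langle\Omega|\big),$$ where the trace is over the auxiliary (bond) space. Then the family of matrices $$B=1\oplus(-1+e^{i\theta})(J^-)^{D-1},\qquad Q=0,\qquad T=1\oplus N_D,\qquad (N_D)_{ab}=\delta_{a+1,b}\quad (N_D\in M_D(\mathbb C)),$$ produces a bulk-uniform phase cMPU with bond dimension $D+1$, up to some redundant gauge transformation. The resulting unitary is $$U_\theta=\mathbb 1+(e^{i\theta}-1)\sum_{j\ge 0}\delta_{D-2,j}\int D^jx\ \mathrm{Ad}_x^j(\Omega),$$ which adds a non-trivial phase on the $(D-2)$-particle sector.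
   Context: $I=[x_-,x_+]=[-\ell/2,\ell/2]$ is an interval, $\mathfrak F=\bigoplus_{N\ge 0}L^2(I)^{\odot N}$ is the bosonic Fock space, $\psi(x)$ is the bosonic field operator with $[\psi(x),\psi^\dagger(y)]=\delta(x-y)\mathbb 1$, and $|\Omega\rangle$ is the Fock vacuum, $\psi(x)|\Omega\rangle=0$. The supermaps acting on field operators are $\mathrm{Id}[X]=X$ and $\mathrm{Ad}_x[X]=\psi^\dagger(x)X\psi(x)$, and $\mathcal P$ denotes path-ordering. Write $$\mathrm{Ad}_x^j(\Omega)=\psi^\dagger(x_1)\cdots\psi^\dagger(x_j)|\Omega\rangle\langle\Omega|\psi(x_j)\cdots\psi(x_1),$$ and let $\int D^jx$ be the integral over path-ordered points, $\int D^jx=\int_I\cdots\int_I dx_1\cdots dx_j\,\Theta(x_1-x_2)\cdots\Theta(x_{j-1}-x_j)$, with $\Theta$ the Heaviside function. The ansatz means its Dyson series. For $Q=0$ and constant $T$ this is $U_\theta=\sum_{j\ge0}\int D^jx\,\mathrm{Tr}(BT^j)\,\mathrm{Ad}^j_x(\Omega)$. A phase cMPU (continuous matrix product unitary) is an operator of this form that is a diagonal unitary, all of whose coefficients (here $\mathrm{Tr}(BT^j)$, $j\ge0$) are complex phases. Its bond dimension is the size of the matrices $B,Q,T$. Bulk-uniform means that $Q,T$ do not depend on $x$. A gauge transformation is a change of matrices induced by an invertible-matrix-valued function $g$ on $I$: the path-ordered exponential $W_x^y$ from $x$ to $y$ becomes $g(y)W_x^yg(x)^{-1}$ and $B$ becomes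 $g(x_-)Bg(x_+)^{-1}$. This leaves $\mathrm{Tr}(BW_{x_-}^{x_+})$, and hence the operator, unchanged.
   Formalization: The phase is on the (D-1)-particle sector (bond dimension minus two), not D-2, since Tr((J^-)^{D-1} N_D^j) vanishes unless j=D-1; J^- is taken in the weight basis with unit entries, since standard entries give a factor (D-1)! and no phase for D≥3. *)

theory Defs
  imports "HOL-Analysis.Analysis" "Jordan_Normal_Form.Matrix"
begin

section \<open>Bosonic Fock space over an interval\<close>

text \<open>
  A Fock vector is represented by its wave functions, collected in one function on lists:
  on lists of length \<open>N\<close> it is the \<open>N\<close>-particle wave function. Vectors are
  identified when all their wave functions agree almost everywhere (\<open>fock_eq\<close>); every class
  in the symmetric tensor power has a representative that is symmetric everywhere.
\<close>

type_synonym wavefun = "real list \<Rightarrow> complex"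

definition interval :: "real \<Rightarrow> real set" where
  "interval l = {- l / 2 .. l / 2}"

definition conf :: "nat \<Rightarrow> real set \<Rightarrow> (nat \<Rightarrow> real) measure" where
  "conf n A = (\<Pi>\<^sub>M i\<in>{..<n}. restrict_space lborel A)"

definition coords :: "nat \<Rightarrow> (nat \<Rightarrow> real) \<Rightarrow> real list" where
  "coords n t = map t [0..<n]"

definition fock :: "real \<Rightarrow> wavefun set" where
  "fock l = {\<Psi>.
     (\<forall>xs ys. mset xs = mset ys \<longrightarrow> \<Psi> xs = \<Psi> ys) \<and>
     (\<forall>n. (\<lambda>t. \<Psi> (coords n t)) \<in> borel_measurable (conf n (interval l))) \<and>
     (\<forall>n. integrable (conf n (interval l)) (\<lambda>t. (cmod (\<Psi> (coords n t)))\<^sup>2)) \<and>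
     summable (\<lambda>n. LINT t|conf n (interval l). (cmod (\<Psi> (coords n t)))\<^sup>2)}"

definition fock_inner :: "real \<Rightarrow> wavefun \<Rightarrow> wavefun \<Rightarrow> complex" where
  "fock_inner l \<Phi> \<Psi> =
     (\<Sum>n. LINT t|conf n (interval l). cnj (\<Phi> (coords n t)) * \<Psi> (coords n t))"

definition fock_eq :: "real \<Rightarrow> wavefun \<Rightarrow> wavefun \<Rightarrow> bool" where
  "fock_eq l \<Phi> \<Psi> \<longleftrightarrow>
     (\<forall>n. AE t in conf n (interval l). \<Phi> (coords n t) = \<Psi> (coords n t))"

definition fock_unitary :: "real \<Rightarrow> (wavefun \<Rightarrow> wavefun) \<Rightarrow> bool" where
  "fock_unitary l U \<longleftrightarrow>
     (\<forall>\<Psi>\<in>fock l. U \<Psi> \<in> fock l) \<and>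
     (\<forall>\<Phi>\<in>fock l. \<forall>\<Psi>\<in>fock l. fock_eq l \<Phi> \<Psi> \<longrightarrow> fock_eq l (U \<Phi>) (U \<Psi>)) \<and>
     (\<forall>\<Phi>\<in>fock l. \<forall>\<Psi>\<in>fock l. \<forall>c.
        fock_eq l (U (\<lambda>xs. c * \<Phi> xs + \<Psi> xs)) (\<lambda>xs. c * U \<Phi> xs + U \<Psi> xs)) \<and>
     (\<forall>\<Phi>\<in>fock l. \<forall>\<Psi>\<in>fock l. fock_inner l (U \<Phi>) (U \<Psi>) = fock_inner l \<Phi> \<Psi>) \<and>
     (\<forall>\<Psi>\<in>fock l. \<exists>\<Phi>\<in>fock l. fock_eq l (U \<Phi>) \<Psi>)"

definition diagonal_with :: "real \<Rightarrow> (wavefun \<Rightarrow> wavefun) \<Rightarrow> (real list \<Rightarrow> complex) \<Rightarrow> bool" where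
  "diagonal_with l U c \<longleftrightarrow> (\<forall>\<Psi>\<in>fock l. fock_eq l (U \<Psi>) (\<lambda>xs. c xs * \<Psi> xs))"


section \<open>Field operators and supermaps\<close>

text \<open>
  The annihilation field \<open>\<psi>(x)\<close> acts pointwise on representatives. The creation field
  \<open>\<psi>\<^sup>\<dagger>(x)\<close> is not an operator on Fock space, so operators built from the fields are
  handled through their matrix elements \<open>\<langle>\<Phi>|X|\<Psi>\<rangle>\<close>:
  \<open>\<langle>\<Phi>|\<psi>\<^sup>\<dagger>(x) X \<psi>(x)|\<Psi>\<rangle> = \<langle>\<psi>(x)\<Phi>|X|\<psi>(x)\<Psi>\<rangle>\<close>.
  The value type \<open>'a\<close> is \<open>complex\<close> for operators and \<open>complex mat\<close> for matrices of operators.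
\<close>

type_synonym 'a form = "wavefun \<Rightarrow> wavefun \<Rightarrow> 'a"

definition annih :: "real \<Rightarrow> wavefun \<Rightarrow> wavefun" where
  "annih x \<Psi> = (\<lambda>xs. complex_of_real (sqrt (real (length xs + 1))) * \<Psi> (x # xs))"

text \<open>\<open>|\<Omega>\<rangle>\<langle>\<Omega>|\<close>, where \<open>\<langle>\<Omega>|\<Psi>\<rangle>\<close> is the value of \<open>\<Psi>\<close> on the empty configuration.\<close>

definition vac_proj :: "complex form" where
  "vac_proj \<Phi> \<Psi> = cnj (\<Phi> []) * \<Psi> []"

definition Id_map :: "'a form \<Rightarrow> 'a form" where
  "Id_map X = X"

definition Ad :: "real \<Rightarrow> 'a form \<Rightarrow> 'a form" where
  "Ad x X = (\<lambda>\<Phi> \<Psi>. X (annih x \<Phi>) (annih x \<Psi>))"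

text \<open>
  For \<open>xs = [x\<^sub>1, \<dots>, x\<^sub>j]\<close> this is
  \<open>\<psi>\<^sup>\<dagger>(x\<^sub>1)\<dots>\<psi>\<^sup>\<dagger>(x\<^sub>j)|\<Omega>\<rangle>\<langle>\<Omega>|\<psi>(x\<^sub>j)\<dots>\<psi>(x\<^sub>1)\<close>.
\<close>

definition Ad_vac :: "real list \<Rightarrow> complex form" where
  "Ad_vac xs = foldr Ad xs vac_proj"


section \<open>Path-ordered exponentials\<close>

definition heaviside :: "real \<Rightarrow> real" where
  "heaviside u = (if 0 < u then 1 else 0)"

definition path_ordered :: "nat \<Rightarrow> (nat \<Rightarrow> real) \<Rightarrow> real" where
  "path_ordered k t = (\<Prod>i<k - 1. heaviside (t i - t (Suc i)))"

definition ordered_integrable :: "real \<Rightarrow> real \<Rightarrow> nat \<Rightarrow> (real list \<Rightarrow> complex) \<Rightarrow> bool" where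
  "ordered_integrable x y k f \<longleftrightarrow>
     integrable (conf k {x..y}) (\<lambda>t. complex_of_real (path_ordered k t) * f (coords k t))"

definition ordered_integral :: "real \<Rightarrow> real \<Rightarrow> nat \<Rightarrow> (real list \<Rightarrow> complex) \<Rightarrow> complex" where
  "ordered_integral x y k f =
     (LINT t|conf k {x..y}. complex_of_real (path_ordered k t) * f (coords k t))"

text \<open>\<open>Q(x) \<otimes> Id + T(x) \<otimes> Ad\<^sub>x\<close>, and its products with the first point outermost.\<close>

definition generator ::
  "(real \<Rightarrow> complex mat) \<Rightarrow> (real \<Rightarrow> complex mat) \<Rightarrow> real \<Rightarrow> complex mat form \<Rightarrow> complex mat form" where
  "generator Q T x Y = (\<lambda>\<Phi> \<Psi>. Q x * Id_map Y \<Phi> \<Psi> + T x * Ad x Y \<Phi> \<Psi>)"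

definition generator_word ::
  "nat \<Rightarrow> (real \<Rightarrow> complex mat) \<Rightarrow> (real \<Rightarrow> complex mat) \<Rightarrow> real list \<Rightarrow> complex form \<Rightarrow> complex mat form"
  where
  "generator_word n Q T xs X = foldr (generator Q T) xs (\<lambda>\<Phi> \<Psi>. X \<Phi> \<Psi> \<cdot>\<^sub>m 1\<^sub>m n)"

text \<open>
  \<open>has_path_exp n Q T x y X \<Phi> \<Psi> W\<close>: the Dyson series of the path-ordered exponential from
  \<open>x\<close> to \<open>y\<close>, applied to \<open>X\<close> and evaluated between \<open>\<Phi>\<close> and \<open>\<Psi>\<close>, is well defined and
  converges to the matrix \<open>W\<close>.
\<close>

definition has_path_exp ::
  "nat \<Rightarrow> (real \<Rightarrow> complex mat) \<Rightarrow> (real \<Rightarrow> complex mat) \<Rightarrow> real \<Rightarrow> real \<Rightarrow>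
   complex form \<Rightarrow> wavefun \<Rightarrow> wavefun \<Rightarrow> complex mat \<Rightarrow> bool" where
  "has_path_exp n Q T x y X \<Phi> \<Psi> W \<longleftrightarrow>
     W \<in> carrier_mat n n \<and>
     (\<forall>a<n. \<forall>b<n.
        (\<forall>k. ordered_integrable x y k (\<lambda>xs. generator_word n Q T xs X \<Phi> \<Psi> $$ (a, b))) \<and>
        (\<lambda>k. ordered_integral x y k (\<lambda>xs. generator_word n Q T xs X \<Phi> \<Psi> $$ (a, b)))
          sums (W $$ (a, b)))"


section \<open>Continuous matrix product unitaries\<close>

definition tr :: "complex mat \<Rightarrow> complex" where
  "tr A = (\<Sum>i<dim_row A. A $$ (i, i))"

text \<open>
  \<open>U\<close> is the operator on Fock space given by the ansatz with bond dimension \<open>n\<close>. This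
  determines \<open>U \<Psi>\<close> up to null sets, since all its matrix elements are prescribed.
\<close>

definition cmpu_operator ::
  "real \<Rightarrow> nat \<Rightarrow> complex mat \<Rightarrow> (real \<Rightarrow> complex mat) \<Rightarrow> (real \<Rightarrow> complex mat) \<Rightarrow>
   (wavefun \<Rightarrow> wavefun) \<Rightarrow> bool" where
  "cmpu_operator l n B Q T U \<longleftrightarrow>
     B \<in> carrier_mat n n \<and>
     (\<forall>x\<in>interval l. Q x \<in> carrier_mat n n \<and> T x \<in> carrier_mat n n) \<and>
     (\<forall>\<Psi>\<in>fock l. U \<Psi> \<in> fock l) \<and>
     (\<forall>\<Phi>\<in>fock l. \<forall>\<Psi>\<in>fock l. \<exists>W.
        has_path_exp n Q T (- l / 2) (l / 2) vac_proj \<Phi> \<Psi> W \<and>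
        fock_inner l \<Phi> (U \<Psi>) = tr (B * W))"

definition phase_cmpu ::
  "real \<Rightarrow> nat \<Rightarrow> complex mat \<Rightarrow> (real \<Rightarrow> complex mat) \<Rightarrow> (real \<Rightarrow> complex mat) \<Rightarrow>
   (wavefun \<Rightarrow> wavefun) \<Rightarrow> bool" where
  "phase_cmpu l n B Q T U \<longleftrightarrow>
     cmpu_operator l n B Q T U \<and> fock_unitary l U \<and>
     (\<exists>c. (\<forall>xs. cmod (c xs) = 1) \<and> diagonal_with l U c)"

definition bulk_uniform ::
  "real \<Rightarrow> (real \<Rightarrow> complex mat) \<Rightarrow> (real \<Rightarrow> complex mat) \<Rightarrow> bool" where
  "bulk_uniform l Q T \<longleftrightarrow>
     (\<forall>x\<in>interval l. \<forall>y\<in>interval l. Q x = Q y \<and> T x = T y)"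

text \<open>
  Gauge transformations are expressed by their effect on path-ordered exponentials rather than
  through \<open>Q' = g Q g\<^sup>-\<^sup>1 + g' g\<^sup>-\<^sup>1\<close>, so no regularity of \<open>g\<close> is needed.
  Here \<open>h\<close> is the pointwise inverse of \<open>g\<close>.
\<close>

definition gauge_related ::
  "real \<Rightarrow> nat \<Rightarrow> complex mat \<Rightarrow> (real \<Rightarrow> complex mat) \<Rightarrow> (real \<Rightarrow> complex mat) \<Rightarrow>
   complex mat \<Rightarrow> (real \<Rightarrow> complex mat) \<Rightarrow> (real \<Rightarrow> complex mat) \<Rightarrow> bool" where
  "gauge_related l n B Q T B' Q' T' \<longleftrightarrow>
     (\<exists>g h.
        (\<forall>x\<in>interval l. g x \<in> carrier_mat n n \<and> h x \<in> carrier_mat n n \<and>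
           g x * h x = 1\<^sub>m n \<and> h x * g x = 1\<^sub>m n) \<and>
        B' = g (- l / 2) * B * h (l / 2) \<and>
        (\<forall>x\<in>interval l. Q' x \<in> carrier_mat n n \<and> T' x \<in> carrier_mat n n) \<and>
        (\<forall>x\<in>interval l. \<forall>y\<in>interval l. x \<le> y \<longrightarrow>
           (\<forall>\<Phi>\<in>fock l. \<forall>\<Psi>\<in>fock l. \<forall>W.
              has_path_exp n Q T x y vac_proj \<Phi> \<Psi> W \<longrightarrow>
              has_path_exp n Q' T' x y vac_proj \<Phi> \<Psi> (g y * W * h x))))"


section \<open>The matrices\<close>

definition shift_mat :: "nat \<Rightarrow> complex mat" where
  "shift_mat D = mat D D (\<lambda>(a, b). if a + 1 = b then 1 else 0)"

text \<open>
  The lowering operator of the \<open>D\<close>-dimensional irreducible representation, in the weight basis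
  \<open>v\<^sub>a = (J\<^sup>-)\<^sup>a v\<^sub>0\<close> generated by the highest weight vector \<open>v\<^sub>0\<close>, so that
  \<open>J\<^sup>- v\<^sub>a = v\<^sub>a\<^sub>+\<^sub>1\<close>. In the orthonormal weight basis the entries are
  \<open>sqrt (k (D - k))\<close> (\<open>spin_lowering\<close>); the power \<open>D - 1\<close> of that matrix has the
  entry \<open>(D - 1)!\<close>, which would not give phases. The two matrices differ by the diagonal
  change of basis in the lemma below.
\<close>

definition J_minus :: "nat \<Rightarrow> complex mat" where
  "J_minus D = mat D D (\<lambda>(a, b). if a = b + 1 then 1 else 0)"

definition spin_lowering :: "nat \<Rightarrow> complex mat" where
  "spin_lowering D =
     mat D D (\<lambda>(a, b). if a = b + 1 then complex_of_real (sqrt (real (a * (D - a)))) else 0)"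

lemma spin_lowering_similar:
  fixes D :: nat and s :: "nat \<Rightarrow> complex"
  defines "s a \<equiv> (\<Prod>k=1..a. complex_of_real (sqrt (real (k * (D - k)))))"
  shows "similar_mat_wit (spin_lowering D) (J_minus D)
           (mat D D (\<lambda>(a, b). if a = b then s a else 0))
           (mat D D (\<lambda>(a, b). if a = b then inverse (s a) else 0))"
proof -
  define c :: "nat \<Rightarrow> complex" where "c k = complex_of_real (sqrt (real (k * (D - k))))" for k
  have s0: "s a \<noteq> 0" if "a < D" for a
    using that by (auto simp: s_def)
  have s_Suc: "s (Suc a) = c (Suc a) * s a" for a
    unfolding s_def c_def by (simp add: mult.commute del: of_nat_mult mult_Suc of_nat_Suc)
  show ?thesis
    unfolding similar_mat_wit_def Let_def spin_lowering_def J_minus_def c_def[symmetric]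
    by (auto intro!: eq_matI simp: scalar_prod_def s0 s_Suc if_distrib[of "\<lambda>z. z * _"]
        if_distrib[of "\<lambda>z. _ * z"] cong: if_cong)
qed

definition B_phase :: "nat \<Rightarrow> real \<Rightarrow> complex mat" where
  "B_phase D \<theta> = diag_block_mat [1\<^sub>m 1, (- 1 + cis \<theta>) \<cdot>\<^sub>m (J_minus D ^\<^sub>m (D - 1))]"

text \<open>
  \<open>(J\<^sup>-)\<^sup>D\<^sup>-\<^sup>1\<close> is the matrix unit in the lower left corner, so only the power
  \<open>j = D - 1\<close> of the shift, two less than the bond dimension \<open>D + 1\<close>, contributes to
  the trace.
\<close>

definition T_phase :: "nat \<Rightarrow> complex mat" where
  "T_phase D = diag_block_mat [1\<^sub>m 1, shift_mat D]"

end

theory Submission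
  imports Defs
begin

text \<open>
  For \<open>Q = 0\<close> and constant \<open>T\<close> the \<open>k\<close>-th Dyson term is \<open>T\<^sup>k\<close> times the ordered integral of
  \<open>Ad_vac xs\<close>. The latter has matrix elements \<open>k! cnj (\<Phi> xs) \<Psi> xs\<close>, so by permutation symmetry its
  ordered integral is the inner product of the \<open>k\<close>-particle components. Hence the ansatz multiplies the
  \<open>k\<close>-particle sector by \<open>tr (B T\<^sup>k)\<close>. The block \<open>1\<close> contributes \<open>1\<close> to every such trace, and
  \<open>(J\<^sup>-)\<^sup>D\<^sup>-\<^sup>1\<close> picks out the corner entry of the nilpotent block, which is nonzero only for
  \<open>k = D - 1\<close>. Gauge invariance is cyclicity of the trace.
\<close>

section \<open>Integrals over ordered configurations\<close>

lemma product_sigma_finite_restrict_lborel: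
  assumes "A \<in> sets borel"
  shows "product_sigma_finite (\<lambda>i::nat. restrict_space lborel A)"
proof -
  have "sigma_finite_measure (restrict_space lborel A)"
    using assms by (intro sigma_finite_measure_restrict_space lborel.sigma_finite_measure_axioms) auto
  then show ?thesis by (simp add: product_sigma_finite_def)
qed

lemma space_conf: "space (conf n A) = {..<n} \<rightarrow>\<^sub>E A"
  by (simp add: conf_def space_PiM space_restrict_space)

lemma measurable_conf_component [measurable]:
  assumes "i < n"
  shows "(\<lambda>t. t i) \<in> borel_measurable (conf n A)"
proof -
  have "(\<lambda>t. t i) \<in> conf n A \<rightarrow>\<^sub>M restrict_space lborel A"
    unfolding conf_def using assms by (intro measurable_component_singleton) auto
  then show ?thesis by (simp add: measurable_restrict_space2_iff)
qed

text \<open>Points of \<open>conf n A\<close> are extensional functions on \<open>{..<n}\<close>.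
  The restriction keeps the permuted point in that space.\<close>

definition permute_conf :: "nat \<Rightarrow> (nat \<Rightarrow> nat) \<Rightarrow> (nat \<Rightarrow> real) \<Rightarrow> nat \<Rightarrow> real" where
  "permute_conf n p t = (\<lambda>i\<in>{..<n}. t (p i))"

lemma measurable_permute_conf:
  assumes "p permutes {..<n}"
  shows "permute_conf n p \<in> conf n A \<rightarrow>\<^sub>M conf n A"
  unfolding permute_conf_def conf_def
  by (intro measurable_restrict measurable_component_singleton)
    (use permutes_in_image[OF assms] in auto)

text \<open>A finite product of sigma-finite measures is determined by its values on boxes. The
  preimage of a box is the box with its sides rearranged by the inverse permutation, and all sides
  carry the same measure, so the product of the side measures is unaffected.\<close>

lemma distr_permute_conf:
  assumes "A \<in> sets borel" and p: "p permutes {..<n}"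
  shows "distr (conf n A) (conf n A) (permute_conf n p) = conf n A"
proof -
  interpret product_sigma_finite "\<lambda>i::nat. restrict_space lborel A"
    by (rule product_sigma_finite_restrict_lborel) fact
  let ?M = "restrict_space lborel A"
  have "distr (conf n A) (conf n A) (permute_conf n p) = (\<Pi>\<^sub>M i\<in>{..<n}. ?M)"
  proof (rule PiM_eqI)
    fix E :: "nat \<Rightarrow> real set"
    assume E: "\<And>i. i \<in> {..<n} \<Longrightarrow> E i \<in> sets ?M"
    have q: "inv_into UNIV p permutes {..<n}" using p by (rule permutes_inv)
    \<comment> \<open>The sides lie in \<open>A\<close>, so every point of a rearranged box already
      belongs to the space of \<open>conf n A\<close>.\<close>
    have sub: "E i \<subseteq> A" if "i < n" for i
      using E[of i] that sets.sets_into_space[of "E i" ?M] by (simp add: space_restrict_space)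
    have pre: "permute_conf n p -` (Pi\<^sub>E {..<n} E) \<inter> space (conf n A) = Pi\<^sub>E {..<n} (\<lambda>i. E (inv_into UNIV p i))"
    proof (intro equalityI subsetI)
      fix t assume t: "t \<in> permute_conf n p -` (Pi\<^sub>E {..<n} E) \<inter> space (conf n A)"
      have "t i \<in> E (inv_into UNIV p i)" if "i < n" for i
      proof -
        have "inv_into UNIV p i < n" using permutes_in_image[OF q, of i] that by simp
        moreover from this t have "permute_conf n p t (inv_into UNIV p i) \<in> E (inv_into UNIV p i)" by auto
        ultimately show ?thesis using permutes_inverses(1)[OF p] by (simp add: permute_conf_def)
      qed
      with t show "t \<in> Pi\<^sub>E {..<n} (\<lambda>i. E (inv_into UNIV p i))" by (auto simp: space_conf PiE_def)
    next
      fix t assume t: "t \<in> Pi\<^sub>E {..<n} (\<lambda>i. E (inv_into UNIV p i))"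
      have "t (p i) \<in> E i" if "i < n" for i
        using t permutes_in_image[OF p, of i] that permutes_inverses(2)[OF p]
        by (metis PiE_mem lessThan_iff)
      moreover have "t i \<in> A" if "i < n" for i
        using sub[of "inv_into UNIV p i"] t that permutes_in_image[OF q, of i] by (auto simp: PiE_iff)
      then have "t \<in> {..<n} \<rightarrow>\<^sub>E A" using t by (auto simp: PiE_iff)
      ultimately show "t \<in> permute_conf n p -` (Pi\<^sub>E {..<n} E) \<inter> space (conf n A)"
        by (auto simp: permute_conf_def space_conf)
    qed
    have "emeasure (distr (conf n A) (conf n A) (permute_conf n p)) (Pi\<^sub>E {..<n} E)
        = emeasure (conf n A) (Pi\<^sub>E {..<n} (\<lambda>i. E (inv_into UNIV p i)))"
      unfolding pre[symmetric]
      by (rule emeasure_distr[OF measurable_permute_conf[OF p]])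
        (use E in \<open>auto simp: conf_def intro!: sets_PiM_I_finite\<close>)
    also have "\<dots> = (\<Prod>i<n. emeasure ?M (E (inv_into UNIV p i)))"
      unfolding conf_def by (intro emeasure_PiM) (use E permutes_in_image[OF q] in auto)
    also have "\<dots> = (\<Prod>i<n. emeasure ?M (E i))"
      using prod.permute[OF q, of "\<lambda>i. emeasure ?M (E i)"] by (simp add: comp_def)
    finally show "emeasure (distr (conf n A) (conf n A) (permute_conf n p)) (Pi\<^sub>E {..<n} E)
        = (\<Prod>i\<in>{..<n}. emeasure ?M (E i))" .
  qed (auto simp: conf_def)
  then show ?thesis by (simp add: conf_def)
qed

text \<open>By Tonelli, coordinate \<open>i\<close> may be integrated out first. With the other
  coordinates fixed, the section of the diagonal is contained in the Lebesgue null set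
  \<open>{t j}\<close>.\<close>

lemma AE_conf_neq:
  assumes A: "A \<in> sets borel" and "i < n" "j < n" "i \<noteq> j"
  shows "AE t in conf n A. t i \<noteq> t j"
proof -
  interpret product_sigma_finite "\<lambda>i::nat. restrict_space lborel A"
    by (rule product_sigma_finite_restrict_lborel) fact
  let ?M = "restrict_space lborel A"
  define J where "J = {..<n} - {i}"
  have J: "finite J" "i \<notin> J" "insert i J = {..<n}" "j \<in> J" using assms by (auto simp: J_def)
  have [measurable]: "(\<lambda>t. t i) \<in> borel_measurable (conf n A)" "(\<lambda>t. t j) \<in> borel_measurable (conf n A)"
    using assms by (auto intro: measurable_conf_component)
  have meas: "{t \<in> space (conf n A). t i = t j} \<in> sets (conf n A)" by measurable
  let ?f = "indicator {t \<in> space (conf n A). t i = t j} :: _ \<Rightarrow> ennreal"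
  have f: "?f \<in> borel_measurable (PiM (insert i J) (\<lambda>i. ?M))"
    using meas by (simp add: J conf_def)
  have "emeasure (conf n A) {t \<in> space (conf n A). t i = t j} = (\<integral>\<^sup>+ t. ?f t \<partial>conf n A)"
    using meas by simp
  also have "\<dots> = (\<integral>\<^sup>+ t. (\<integral>\<^sup>+ y. ?f (t(i := y)) \<partial>?M) \<partial>PiM J (\<lambda>i. ?M))"
    using product_nn_integral_insert[OF J(1,2) f] by (simp add: J conf_def)
  also have "\<dots> \<le> (\<integral>\<^sup>+ t. 0 \<partial>PiM J (\<lambda>i. ?M))"
  proof (rule nn_integral_mono)
    fix t assume t: "t \<in> space (PiM J (\<lambda>i. ?M))"
    have tj: "t j \<in> A" using t J by (auto simp: space_PiM space_restrict_space)
    have "(\<integral>\<^sup>+ y. ?f (t(i := y)) \<partial>?M) \<le> (\<integral>\<^sup>+ y. indicator {t j} y \<partial>?M)"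
      using assms by (intro nn_integral_mono) (auto simp: indicator_def)
    also have "\<dots> = emeasure ?M {t j}"
      using tj A by (subst nn_integral_indicator) (auto simp: sets_restrict_space_iff)
    also have "\<dots> = 0"
      using tj A by (subst emeasure_restrict_space) (auto)
    finally show "(\<integral>\<^sup>+ y. ?f (t(i := y)) \<partial>?M) \<le> 0" .
  qed
  finally have "emeasure (conf n A) {t \<in> space (conf n A). t i = t j} = 0" by simp
  then show ?thesis using meas by (subst AE_iff_measurable[OF meas]) auto
qed

lemma AE_conf_inj:
  assumes "A \<in> sets borel"
  shows "AE t in conf n A. inj_on t {..<n}"
proof -
  have "AE t in conf n A. \<forall>i\<in>{..<n}. \<forall>j\<in>{..<n}. i \<noteq> j \<longrightarrow> t i \<noteq> t j"
    using AE_conf_neq[OF assms]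
    by (intro AE_finite_allI finite_lessThan) (auto intro: AE_I2)
  then show ?thesis by eventually_elim (auto simp: inj_on_def)
qed

text \<open>Transitivity of \<open>>\<close> extends the comparison of neighbours to all pairs.
  Since \<open>heaviside 0 = 0\<close>, ties are excluded and the order is strict.\<close>

lemma path_ordered_eq:
  "path_ordered n t = of_bool (sorted_wrt (>) (coords n t))"
proof (cases "\<forall>i<n - 1. t (Suc i) < t i")
  case True
  then have "sorted_wrt (>) (coords n t)"
    unfolding coords_def
    by (subst sorted_wrt_iff_nth_Suc_transp) (auto simp: less_diff_conv)
  then show ?thesis using True by (auto simp: path_ordered_def heaviside_def intro!: prod.neutral)
next
  case False
  then obtain i where i: "i < n - 1" "\<not> t (Suc i) < t i" by blast
  have "\<not> sorted_wrt (>) (coords n t)"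
  proof
    assume "sorted_wrt (>) (coords n t)"
    then have "coords n t ! Suc i < coords n t ! i"
      using i by (intro sorted_wrt_nth_less[where P = "(>)"]) (auto simp: coords_def)
    then show False using i by (simp add: coords_def)
  qed
  moreover have "path_ordered n t = 0"
    unfolding path_ordered_def using i by (intro prod_zero) (auto simp: heaviside_def)
  ultimately show ?thesis by simp
qed

section \<open>Decreasing rearrangements of a configuration\<close>

lemma coords_permute_conf:
  "p permutes {..<n} \<Longrightarrow> coords n (permute_conf n p t) = map (t \<circ> p) [0..<n]"
  by (auto simp: coords_def permute_conf_def)

lemma mset_coords_permute_conf:
  assumes "p permutes {..<n}"
  shows "mset (coords n (permute_conf n p t)) = mset (coords n t)"
proof -
  have "mset (map p [0..<n]) = mset [0..<n]"
    using permutes_image_mset[OF assms] by (simp add: atLeast0LessThan)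
  then have "image_mset t (mset (map p [0..<n])) = image_mset t (mset [0..<n])" by simp
  then show ?thesis
    unfolding coords_permute_conf[OF assms] by (simp add: coords_def multiset.map_comp)
qed

text \<open>Every summand is 0 or 1. A set of \<open>n\<close> distinct reals has exactly one
  decreasing enumeration, so exactly one summand is 1.\<close>

lemma sum_path_ordered_permute:
  assumes inj: "inj_on t {..<n}"
  shows "(\<Sum>p | p permutes {..<n}. path_ordered n (permute_conf n p t)) = 1"
proof -
  let ?ord = "\<lambda>p. sorted_wrt (>) (map (t \<circ> p) [0..<n])"
  define ys where "ys = rev (sorted_list_of_set (t ` {..<n}))"
  have len: "length ys = n" using inj by (simp add: ys_def card_image)
  have set: "set ys = t ` {..<n}" by (simp add: ys_def)
  have "distinct ys" by (simp add: ys_def)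
  have ord: "sorted_wrt (>) ys" by (simp add: ys_def sorted_wrt_rev strict_sorted_list_of_set)
  have "\<exists>p. p permutes {..<n} \<and> ?ord p"
  proof -
    \<comment> \<open>\<open>p i\<close> is the index at which \<open>t\<close> takes its
      \<open>i\<close>-th largest value, counted from 0. Outside \<open>{..<n}\<close> it is the
      identity, as \<open>permutes\<close> demands.\<close>
    define p where "p i = (if i < n then inv_into {..<n} t (ys ! i) else i)" for i
    have tp: "t (p i) = ys ! i" "p i < n" if "i < n" for i
    proof -
      have *: "ys ! i \<in> t ` {..<n}" using that set len nth_mem by metis
      show "t (p i) = ys ! i" using f_inv_into_f[OF *] that by (simp add: p_def)
      show "p i < n" using inv_into_into[OF *] that by (simp add: p_def)
    qed
    have "inj_on p {..<n}"
      using tp \<open>distinct ys\<close> len by (auto intro!: inj_onI simp: distinct_conv_nth) metis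
    then have "bij_betw p {..<n} {..<n}"
      using tp endo_inj_surj[of "{..<n}" p] by (auto simp: bij_betw_def)
    then have "p permutes {..<n}" by (rule bij_imp_permutes) (simp add: p_def)
    moreover have "map (t \<circ> p) [0..<n] = ys"
      using tp len by (auto intro: nth_equalityI)
    ultimately show ?thesis using ord by metis
  qed
  then obtain p where p: "p permutes {..<n}" "?ord p" by blast
  have uniq: "q = p" if q: "q permutes {..<n}" "?ord q" for q
  proof -
    have "set (map (t \<circ> r) [0..<n]) = t ` {..<n}" if "r permutes {..<n}" for r
      using permutes_image[OF that]
      by (simp add: atLeast0LessThan) (metis image_image)
    then have "set (map (t \<circ> q) [0..<n]) = set (map (t \<circ> p) [0..<n])" using p q by metis
    \<comment> \<open>Reversal makes both lists strictly increasing, and such a list is determined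
      by its set of elements.\<close>
    then have "rev (map (t \<circ> q) [0..<n]) = rev (map (t \<circ> p) [0..<n])"
      using p q by (intro strict_sorted_equal) (auto simp del: rev_map map_map simp: sorted_wrt_rev rev_map[symmetric])
    then have eq: "map (t \<circ> q) [0..<n] = map (t \<circ> p) [0..<n]" by (metis rev_rev_ident)
    have "q i = p i" for i
    proof (cases "i < n")
      case True
      then have "t (q i) = t (p i)" using eq by auto
      then show ?thesis
        using inj True permutes_in_image[OF p(1)] permutes_in_image[OF q(1)] by (auto dest!: inj_onD)
    next
      case False
      then show ?thesis using p q by (simp add: permutes_not_in)
    qed
    then show ?thesis by blast
  qed
  have "(\<Sum>q | q permutes {..<n}. path_ordered n (permute_conf n q t))
      = (\<Sum>q | q permutes {..<n}. if q = p then 1 else 0)"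
  proof (rule sum.cong[OF refl])
    fix q assume "q \<in> {q. q permutes {..<n}}"
    then have q: "q permutes {..<n}" by simp
    have "path_ordered n (permute_conf n q t) = of_bool (?ord q)"
      by (simp only: path_ordered_eq coords_permute_conf[OF q])
    also have "?ord q \<longleftrightarrow> q = p" using p(2) uniq[OF q] by blast
    finally show "path_ordered n (permute_conf n q t) = (if q = p then 1 else 0)"
      by (simp only: of_bool_def)
  qed
  also have "\<dots> = 1" using p by (simp add: finite_permutations)
  finally show ?thesis .
qed

lemma measurable_path_ordered [measurable]:
  "path_ordered n \<in> borel_measurable (conf n A)"
proof -
  have "(\<lambda>t. heaviside (t i - t (Suc i))) \<in> borel_measurable (conf n A)" if "i < n - 1" for i
  proof -
    have [measurable]: "(\<lambda>t. t i) \<in> borel_measurable (conf n A)"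
      "(\<lambda>t. t (Suc i)) \<in> borel_measurable (conf n A)"
      using that by (auto intro: measurable_conf_component)
    show ?thesis unfolding heaviside_def by measurable
  qed
  then show ?thesis unfolding path_ordered_def[abs_def] by (intro borel_measurable_prod) auto
qed

text \<open>The ordering factor takes only the values 0 and 1, so the product is dominated by
  \<open>f\<close>.\<close>

lemma integrable_path_ordered_mult:
  fixes f :: "(nat \<Rightarrow> real) \<Rightarrow> complex"
  assumes "integrable (conf n A) f"
  shows "integrable (conf n A) (\<lambda>t. complex_of_real (path_ordered n t) * f t)"
proof (rule Bochner_Integration.integrable_bound[OF assms])
  have [measurable]: "f \<in> borel_measurable (conf n A)"
    using assms by (rule borel_measurable_integrable)
  show "(\<lambda>t. complex_of_real (path_ordered n t) * f t) \<in> borel_measurable (conf n A)"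
    by measurable
qed (auto simp: path_ordered_eq)

text \<open>Almost every configuration has exactly one decreasing rearrangement, and all
  rearrangements contribute equally to the integral of a symmetric function.\<close>

lemma ordered_integral_symmetric:
  fixes f :: "real list \<Rightarrow> complex"
  assumes A: "A \<in> sets borel"
    and sym: "\<And>xs ys. mset xs = mset ys \<Longrightarrow> f xs = f ys"
    and int: "integrable (conf n A) (\<lambda>t. f (coords n t))"
  shows "(LINT t|conf n A. f (coords n t)) =
    fact n * (LINT t|conf n A. complex_of_real (path_ordered n t) * f (coords n t))"
proof -
  let ?g = "\<lambda>t. complex_of_real (path_ordered n t) * f (coords n t)"
  let ?P = "{p. p permutes {..<n}}"
  have g: "integrable (conf n A) ?g" by (rule integrable_path_ordered_mult[OF int])
  have perm: "integrable (conf n A) (\<lambda>t. ?g (permute_conf n p t))"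
    "(LINT t|conf n A. ?g (permute_conf n p t)) = (LINT t|conf n A. ?g t)"
    if p: "p permutes {..<n}" for p
  proof -
    note m = measurable_permute_conf[OF p, of A]
    note d = distr_permute_conf[OF A p]
    show "integrable (conf n A) (\<lambda>t. ?g (permute_conf n p t))"
      using integrable_distr[OF m, of ?g] g by (simp add: d)
    show "(LINT t|conf n A. ?g (permute_conf n p t)) = (LINT t|conf n A. ?g t)"
      using integral_distr[OF m borel_measurable_integrable[OF g]] by (simp add: d)
  qed
  \<comment> \<open>Off the null set of coinciding coordinates the ordering factors of all
    rearrangements add up to 1. Symmetry of \<open>f\<close> lets each factor be paired with
    \<open>f\<close> at the rearranged point.\<close>
  have "(LINT t|conf n A. f (coords n t))
      = (LINT t|conf n A. (\<Sum>p\<in>?P. ?g (permute_conf n p t)))"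
  proof (rule integral_cong_AE)
    show "(\<lambda>t. f (coords n t)) \<in> borel_measurable (conf n A)"
      using int by (rule borel_measurable_integrable)
    show "(\<lambda>t. \<Sum>p\<in>?P. ?g (permute_conf n p t)) \<in> borel_measurable (conf n A)"
      using borel_measurable_integrable[OF perm(1)] by (intro borel_measurable_sum) simp
    show "AE t in conf n A. f (coords n t) = (\<Sum>p\<in>?P. ?g (permute_conf n p t))"
      using AE_conf_inj[OF A]
    proof eventually_elim
      case (elim t)
      have "(\<Sum>p\<in>?P. ?g (permute_conf n p t))
          = (\<Sum>p\<in>?P. complex_of_real (path_ordered n (permute_conf n p t)) * f (coords n t))"
        using sym[OF mset_coords_permute_conf] by (intro sum.cong) auto
      also have "\<dots> = complex_of_real (\<Sum>p\<in>?P. path_ordered n (permute_conf n p t)) * f (coords n t)"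
        by (simp add: sum_distrib_right)
      finally show ?case using sum_path_ordered_permute[OF elim] by simp
    qed
  qed
  also have "\<dots> = (\<Sum>p\<in>?P. LINT t|conf n A. ?g (permute_conf n p t))"
    using perm by (intro Bochner_Integration.integral_sum) auto
  also have "\<dots> = (\<Sum>p\<in>?P. LINT t|conf n A. ?g t)" using perm by (intro sum.cong) auto
  also have "\<dots> = fact n * (LINT t|conf n A. ?g t)"
    using card_permutations[of "{..<n}" n] by simp
  finally show ?thesis .
qed

section \<open>The matrices\<close>

lemma T_phase_carrier: "T_phase D \<in> carrier_mat (D + 1) (D + 1)"
  by (auto simp: T_phase_def shift_mat_def)

text \<open>Index 0 is the trivial block, and the nilpotent block occupies the indices 1 to
  \<open>D\<close>. A power of the shift has its ones on the \<open>k\<close>-th superdiagonal,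
  which leaves the block once \<open>k\<close> reaches \<open>D\<close>.\<close>

lemma T_phase_pow:
  "T_phase D ^\<^sub>m k = mat (D + 1) (D + 1) (\<lambda>(a, b). of_bool (a = 0 \<and> b = 0 \<or> 0 < a \<and> b = a + k))"
proof (induction k)
  case 0
  then show ?case by (auto intro!: eq_matI simp: T_phase_def shift_mat_def)
next
  case (Suc k)
  have T: "T_phase D = mat (D + 1) (D + 1) (\<lambda>(a, b). of_bool (a = 0 \<and> b = 0 \<or> 0 < a \<and> b = a + 1))"
    by (auto intro!: eq_matI simp: T_phase_def shift_mat_def split: if_splits)
  show ?case
  proof (rule eq_matI)
    fix a b
    assume "a < dim_row (mat (D + 1) (D + 1) (\<lambda>(a, b). of_bool (a = 0 \<and> b = 0 \<or> 0 < a \<and> b = a + Suc k)) :: complex mat)"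
      and "b < dim_col (mat (D + 1) (D + 1) (\<lambda>(a, b). of_bool (a = 0 \<and> b = 0 \<or> 0 < a \<and> b = a + Suc k)) :: complex mat)"
    then have ab: "a < D + 1" "b < D + 1" by simp_all
    have "(T_phase D ^\<^sub>m Suc k) $$ (a, b) = (\<Sum>c\<in>{0..<D + 1}.
        of_bool (a = 0 \<and> c = 0 \<or> 0 < a \<and> c = a + k) * of_bool (c = 0 \<and> b = 0 \<or> 0 < c \<and> b = c + 1))"
      using ab by (subst pow_mat.simps, subst Suc) (simp add: T scalar_prod_def)
    \<comment> \<open>Row \<open>a\<close> of the \<open>k\<close>-th power has at most one nonzero
      entry, so a single \<open>c\<close> survives. If \<open>a + k\<close> exceeds
      \<open>D\<close>, no \<open>c\<close> qualifies, and the target entry is 0 as well because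
      \<open>b\<close> is at most \<open>D\<close>.\<close>
    also have "\<dots> = (\<Sum>c\<in>{0..<D + 1}. if c = (if a = 0 then 0 else a + k)
        then of_bool (a = 0 \<and> b = 0 \<or> 0 < a \<and> b = a + Suc k) else 0)"
      by (intro sum.cong) (auto simp: of_bool_def)
    also have "\<dots> = of_bool (a = 0 \<and> b = 0 \<or> 0 < a \<and> b = a + Suc k)"
      using ab by (subst sum.delta) auto
    finally show "(T_phase D ^\<^sub>m Suc k) $$ (a, b) =
        mat (D + 1) (D + 1) (\<lambda>(a, b). of_bool (a = 0 \<and> b = 0 \<or> 0 < a \<and> b = a + Suc k)) $$ (a, b)"
      using ab by simp
  qed (auto simp: T_phase_def shift_mat_def)
qed

text \<open>Each factor lowers a weight vector by one step. For \<open>k = D - 1\<close> only the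
  passage from highest to lowest weight remains, with entry exactly 1 in this basis.\<close>

lemma J_minus_pow:
  "J_minus D ^\<^sub>m k = mat D D (\<lambda>(a, b). of_bool (a = b + k))"
proof (induction k)
  case 0
  then show ?case by (auto intro!: eq_matI simp: J_minus_def)
next
  case (Suc k)
  show ?case
  proof (rule eq_matI)
    fix a b
    assume "a < dim_row (mat D D (\<lambda>(a, b). of_bool (a = b + Suc k)) :: complex mat)"
      and "b < dim_col (mat D D (\<lambda>(a, b). of_bool (a = b + Suc k)) :: complex mat)"
    then have ab: "a < D" "b < D" by simp_all
    have "(J_minus D ^\<^sub>m Suc k) $$ (a, b) =
        (\<Sum>c\<in>{0..<D}. of_bool (a = c + k) * (if c = b + 1 then 1 else 0))"
      using ab by (subst pow_mat.simps, subst Suc) (simp add: J_minus_def scalar_prod_def)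
    also have "\<dots> = (\<Sum>c\<in>{0..<D}. if c = b + 1 then of_bool (a = b + Suc k) else 0)"
      by (intro sum.cong) auto
    also have "\<dots> = of_bool (a = b + Suc k)"
      using ab by (subst sum.delta) auto
    finally show "(J_minus D ^\<^sub>m Suc k) $$ (a, b) =
        mat D D (\<lambda>(a, b). of_bool (a = b + Suc k)) $$ (a, b)"
      using ab by simp
  qed (auto simp: J_minus_def)
qed

lemma B_phase_carrier: "B_phase D \<theta> \<in> carrier_mat (D + 1) (D + 1)"
  by (auto simp: B_phase_def J_minus_pow)

text \<open>The corner entry \<open>(D - 1, 0)\<close> of the lowering block moves to
  \<open>(D, 1)\<close> because the trivial block comes first.\<close>

lemma B_phase_eq:
  assumes "0 < D"
  shows "B_phase D \<theta> = mat (D + 1) (D + 1)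
    (\<lambda>(a, b). if a = 0 \<and> b = 0 then 1 else if a = D \<and> b = 1 then cis \<theta> - 1 else 0)"
  using assms by (auto intro!: eq_matI simp: B_phase_def J_minus_pow)

text \<open>\<open>B_phase\<close> has support only at \<open>(0, 0)\<close> and
  \<open>(D, 1)\<close>, so the trace reads off the transposed positions of \<open>X\<close>. The
  general \<open>X\<close> covers both powers of \<open>T_phase\<close> and path-ordered
  exponentials.\<close>

lemma tr_B_phase_mult:
  assumes "0 < D" and X: "X \<in> carrier_mat (D + 1) (D + 1)"
  shows "tr (B_phase D \<theta> * X) = X $$ (0, 0) + (cis \<theta> - 1) * X $$ (1, D)"
proof -
  let ?u = "cis \<theta> - 1"
  have "tr (B_phase D \<theta> * X) = (\<Sum>a<D + 1. \<Sum>b\<in>{0..<D + 1}.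
      (if a = 0 \<and> b = 0 then 1 else if a = D \<and> b = 1 then ?u else 0) * X $$ (b, a))"
    unfolding tr_def using X by (simp add: B_phase_eq[OF assms(1)] scalar_prod_def del: sum.lessThan_Suc sum.op_ivl_Suc)
  also have "\<dots> = (\<Sum>a<D + 1. (if a = 0 then X $$ (0, 0) else 0) + (if a = D then ?u * X $$ (1, D) else 0))"
  proof (rule sum.cong[OF refl])
    fix a
    have "(\<Sum>b\<in>{0..<D + 1}. (if a = 0 \<and> b = 0 then 1 else if a = D \<and> b = 1 then ?u else 0) * X $$ (b, a))
      = (\<Sum>b\<in>{0..<D + 1}. (if b = 0 then if a = 0 then X $$ (0, 0) else 0 else 0)
          + (if b = 1 then if a = D then ?u * X $$ (1, D) else 0 else 0))"
      by (intro sum.cong) auto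
    also have "\<dots> = (if a = 0 then X $$ (0, 0) else 0) + (if a = D then ?u * X $$ (1, D) else 0)"
      unfolding sum.distrib using assms by (subst (1 2) sum.delta) auto
    finally show "(\<Sum>b\<in>{0..<D + 1}. (if a = 0 \<and> b = 0 then 1 else if a = D \<and> b = 1 then ?u else 0) * X $$ (b, a))
      = (if a = 0 then X $$ (0, 0) else 0) + (if a = D then ?u * X $$ (1, D) else 0)" .
  qed
  also have "\<dots> = X $$ (0, 0) + ?u * X $$ (1, D)"
    unfolding sum.distrib by (subst (1 2) sum.delta) auto
  finally show ?thesis .
qed

text \<open>The trivial block always gives 1. The entry \<open>(1, D)\<close> of the
  \<open>j\<close>-th power is nonzero exactly when \<open>D = 1 + j\<close>, and then the total is
  \<open>1 + (cis \<theta> - 1)\<close>.\<close>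

lemma tr_B_T_pow:
  assumes "0 < D"
  shows "tr (B_phase D \<theta> * T_phase D ^\<^sub>m j) = (if j = D - 1 then cis \<theta> else 1)"
proof -
  have "T_phase D ^\<^sub>m j \<in> carrier_mat (D + 1) (D + 1)" by (rule pow_carrier_mat) (rule T_phase_carrier)
  then show ?thesis
    using assms by (auto simp: tr_B_phase_mult) (auto simp: T_phase_pow)
qed

section \<open>Cyclicity of the trace and gauge invariance\<close>

lemma tr_mult_commute:
  assumes "A \<in> carrier_mat n n" "B \<in> carrier_mat n n"
  shows "tr (A * B) = tr (B * A)"
proof -
  have "tr (A * B) = (\<Sum>i<n. \<Sum>j<n. A $$ (i, j) * B $$ (j, i))"
    using assms by (simp add: tr_def scalar_prod_def atLeast0LessThan)
  also have "\<dots> = (\<Sum>j<n. \<Sum>i<n. B $$ (j, i) * A $$ (i, j))"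
    by (subst sum.swap) (simp add: mult.commute)
  also have "\<dots> = tr (B * A)"
    using assms by (simp add: tr_def scalar_prod_def atLeast0LessThan)
  finally show ?thesis .
qed

text \<open>Here \<open>g\<close>, \<open>h\<close> are the gauge matrix and its inverse at the left
  endpoint, and \<open>k\<close>, \<open>m\<close> those at the right endpoint. The pair
  \<open>m * k\<close> cancels in place, and \<open>h * g\<close> cancels after a cyclic
  rotation.\<close>

lemma tr_gauge_invariant:
  assumes "B \<in> carrier_mat n n" "W \<in> carrier_mat n n"
    and g: "g \<in> carrier_mat n n" "h \<in> carrier_mat n n" "h * g = 1\<^sub>m n"
    and k: "k \<in> carrier_mat n n" "m \<in> carrier_mat n n" "m * k = 1\<^sub>m n"
  shows "tr ((g * B * m) * (k * W * h)) = tr (B * W)"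
proof -
  have "m * (k * (W * h)) = (m * k) * (W * h)"
    using assms by (intro assoc_mult_mat[symmetric]) auto
  then have "m * (k * (W * h)) = W * h" using assms by simp
  then have "(g * B * m) * (k * W * h) = g * (B * (W * h))"
    using assms(1-5,6,7) by (simp add: assoc_mult_mat[of _ n n _ n _ n])
  also have "tr \<dots> = tr ((B * (W * h)) * g)"
    using assms by (intro tr_mult_commute[of _ n]) auto
  also have "(B * (W * h)) * g = B * (W * (h * g))"
    using assms(1-4) by (simp add: assoc_mult_mat[of _ n n _ n _ n])
  also have "\<dots> = B * W" using assms by simp
  finally show ?thesis .
qed

section \<open>Words of the generator\<close>

lemma Ad_apply: "Ad x X \<Phi> \<Psi> = X (annih x \<Phi>) (annih x \<Psi>)"
  by (simp add: Ad_def)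

text \<open>The outermost \<open>Ad\<close> acts first on the wave functions, so
  \<open>foldr\<close> on forms turns into \<open>fold\<close> on their arguments.\<close>

lemma foldr_annih:
  "foldr Ad xs X \<Phi> \<Psi> = X (fold annih xs \<Phi>) (fold annih xs \<Psi>)"
  by (induction xs arbitrary: \<Phi> \<Psi>) (auto simp: Ad_apply)

text \<open>Each annihilation contributes the square root of the current particle number. Their
  product telescopes to a quotient of factorials.\<close>

lemma fold_annih:
  "fold annih xs \<Psi> ys = complex_of_real (sqrt (fact (length xs + length ys) / fact (length ys))) * \<Psi> (xs @ ys)"
proof (induction xs arbitrary: \<Psi>)
  case (Cons x xs)
  have *: "fact (length xs + length ys) / fact (length ys) * (1 + (real (length xs) + real (length ys)))
    = (fact (Suc (length xs + length ys)) / fact (length ys) :: real)"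
    by (simp add: field_simps)
  have "fold annih (x # xs) \<Psi> ys
      = complex_of_real (sqrt (fact (length xs + length ys) / fact (length ys)) * sqrt (1 + (real (length xs) + real (length ys))))
        * \<Psi> (x # xs @ ys)"
    by (simp only: fold.simps comp_apply Cons) (simp add: annih_def add_ac)
  also have "sqrt (fact (length xs + length ys) / fact (length ys)) * sqrt (1 + (real (length xs) + real (length ys)))
      = sqrt (fact (length (x # xs) + length ys) / fact (length ys))"
    unfolding real_sqrt_mult[symmetric] * by simp
  finally show ?case by simp
qed simp

text \<open>Bra and ket each contribute the square root of the factorial.\<close>

lemma Ad_vac_eq: "Ad_vac xs \<Phi> \<Psi> = fact (length xs) * (cnj (\<Phi> xs) * \<Psi> xs)"
proof -
  have "Ad_vac xs \<Phi> \<Psi> = vac_proj (fold annih xs \<Phi>) (fold annih xs \<Psi>)"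
    unfolding Ad_vac_def using foldr_annih[of xs vac_proj] by simp
  also have "\<dots> = complex_of_real (sqrt (fact (length xs)) * sqrt (fact (length xs))) * (cnj (\<Phi> xs) * \<Psi> xs)"
    unfolding of_real_mult by (simp add: vac_proj_def fold_annih)
  finally show ?thesis by (simp del: of_real_mult)
qed

text \<open>With vanishing \<open>Q\<close>, every letter contributes one \<open>T\<close> on the
  bond space and one \<open>Ad\<close> on the form. The two act on different factors, so they can be
  collected separately.\<close>

lemma generator_word_const:
  assumes T: "T \<in> carrier_mat n n"
  shows "generator_word n (\<lambda>x. 0\<^sub>m n n) (\<lambda>x. T) xs X \<Phi> \<Psi>
    = foldr Ad xs X \<Phi> \<Psi> \<cdot>\<^sub>m T ^\<^sub>m length xs"
proof (induction xs arbitrary: \<Phi> \<Psi>)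
  case Nil
  then show ?case using T by (simp add: generator_word_def)
next
  case (Cons x xs)
  let ?c = "foldr Ad xs X"
  have P: "T ^\<^sub>m k \<in> carrier_mat n n" for k using T by simp
  \<comment> \<open>The word attaches a new \<open>T\<close> on the left, whereas
    \<open>pow_mat\<close> attaches it on the right.\<close>
  have comm: "T * T ^\<^sub>m k = T ^\<^sub>m k * T" for k
  proof (induction k)
    case (Suc k)
    then show ?case using assoc_mult_mat[OF T P T, of k] by simp
  qed (use T in simp)
  have "generator_word n (\<lambda>x. 0\<^sub>m n n) (\<lambda>x. T) (x # xs) X \<Phi> \<Psi>
    = 0\<^sub>m n n * generator_word n (\<lambda>x. 0\<^sub>m n n) (\<lambda>x. T) xs X \<Phi> \<Psi>
      + T * generator_word n (\<lambda>x. 0\<^sub>m n n) (\<lambda>x. T) xs X (annih x \<Phi>) (annih x \<Psi>)"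
    by (simp add: generator_word_def generator_def Id_map_def Ad_apply)
  also have "\<dots> = ?c (annih x \<Phi>) (annih x \<Psi>) \<cdot>\<^sub>m T ^\<^sub>m length (x # xs)"
    unfolding Cons using T P mult_carrier_mat[OF P T] by (auto simp: mult_smult_distrib[of T n n _ n] comm)
  also have "?c (annih x \<Phi>) (annih x \<Psi>) = foldr Ad (x # xs) X \<Phi> \<Psi>"
    by (simp add: Ad_apply)
  finally show ?case .
qed

lemma generator_word_entry:
  assumes "T \<in> carrier_mat n n" "a < n" "b < n"
  shows "generator_word n (\<lambda>x. 0\<^sub>m n n) (\<lambda>x. T) xs vac_proj \<Phi> \<Psi> $$ (a, b)
    = (T ^\<^sub>m length xs) $$ (a, b) * Ad_vac xs \<Phi> \<Psi>"
  using assms by (simp add: generator_word_const Ad_vac_def)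

section \<open>Diagonal operators on Fock space\<close>

lemma fockD:
  assumes "\<Psi> \<in> fock l"
  shows fock_symmetric: "mset xs = mset ys \<Longrightarrow> \<Psi> xs = \<Psi> ys"
    and fock_measurable: "(\<lambda>t. \<Psi> (coords n t)) \<in> borel_measurable (conf n (interval l))"
    and fock_integrable: "integrable (conf n (interval l)) (\<lambda>t. (cmod (\<Psi> (coords n t)))\<^sup>2)"
    and fock_summable: "summable (\<lambda>n. LINT t|conf n (interval l). (cmod (\<Psi> (coords n t)))\<^sup>2)"
  using assms unfolding fock_def by blast+

definition sector_inner :: "real \<Rightarrow> nat \<Rightarrow> wavefun \<Rightarrow> wavefun \<Rightarrow> complex" where
  "sector_inner l n \<Phi> \<Psi> = (LINT t|conf n (interval l). cnj (\<Phi> (coords n t)) * \<Psi> (coords n t))"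

lemma cmod_cnj_mult_le: "cmod (cnj a * b) \<le> (cmod a)\<^sup>2 + (cmod b)\<^sup>2"
proof -
  have "2 * (cmod a * cmod b) \<le> (cmod a)\<^sup>2 + (cmod b)\<^sup>2"
    using zero_le_power2[of "cmod a - cmod b"] by (simp add: power2_eq_square algebra_simps)
  moreover have "0 \<le> cmod a * cmod b" by simp
  ultimately have "cmod a * cmod b \<le> (cmod a)\<^sup>2 + (cmod b)\<^sup>2" by linarith
  then show ?thesis by (simp add: norm_mult)
qed

text \<open>The integrand is dominated by the sum of the two squared moduli.\<close>

lemma sector_integrable:
  assumes "\<Phi> \<in> fock l" "\<Psi> \<in> fock l"
  shows "integrable (conf n (interval l)) (\<lambda>t. cnj (\<Phi> (coords n t)) * \<Psi> (coords n t))"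
proof (rule Bochner_Integration.integrable_bound)
  show "integrable (conf n (interval l))
      (\<lambda>t. (cmod (\<Phi> (coords n t)))\<^sup>2 + (cmod (\<Psi> (coords n t)))\<^sup>2)"
    using assms by (intro Bochner_Integration.integrable_add fock_integrable)
  have [measurable]: "(\<lambda>t. \<Phi> (coords n t)) \<in> borel_measurable (conf n (interval l))"
    "(\<lambda>t. \<Psi> (coords n t)) \<in> borel_measurable (conf n (interval l))"
    using assms by (auto intro: fock_measurable)
  show "(\<lambda>t. cnj (\<Phi> (coords n t)) * \<Psi> (coords n t)) \<in> borel_measurable (conf n (interval l))"
    by (intro borel_measurable_times borel_measurable_continuous_on[of cnj, OF continuous_on_cnj[OF continuous_on_id]]) auto
  show "AE t in conf n (interval l). norm (cnj (\<Phi> (coords n t)) * \<Psi> (coords n t))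
      \<le> norm ((cmod (\<Phi> (coords n t)))\<^sup>2 + (cmod (\<Psi> (coords n t)))\<^sup>2)"
    using cmod_cnj_mult_le by (auto intro!: AE_I2)
qed

text \<open>The same bound, summed over sectors, gives absolute convergence. This allows comparison
  with series whose terms carry bounded coefficients.\<close>

lemma sector_inner_summable:
  assumes "\<Phi> \<in> fock l" "\<Psi> \<in> fock l"
  shows "summable (\<lambda>n. norm (sector_inner l n \<Phi> \<Psi>))"
proof (rule summable_comparison_test'[where N = 0])
  show "summable (\<lambda>n. (LINT t|conf n (interval l). (cmod (\<Phi> (coords n t)))\<^sup>2)
      + (LINT t|conf n (interval l). (cmod (\<Psi> (coords n t)))\<^sup>2))"
    using assms by (intro summable_add fock_summable)
  fix n
  have "norm (sector_inner l n \<Phi> \<Psi>)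
      \<le> (LINT t|conf n (interval l). norm (cnj (\<Phi> (coords n t)) * \<Psi> (coords n t)))"
    unfolding sector_inner_def by (rule integral_norm_bound)
  also have "\<dots> \<le> (LINT t|conf n (interval l). (cmod (\<Phi> (coords n t)))\<^sup>2 + (cmod (\<Psi> (coords n t)))\<^sup>2)"
    using assms cmod_cnj_mult_le
    by (intro integral_mono integrable_norm sector_integrable Bochner_Integration.integrable_add fock_integrable)
  also have "\<dots> = (LINT t|conf n (interval l). (cmod (\<Phi> (coords n t)))\<^sup>2)
      + (LINT t|conf n (interval l). (cmod (\<Psi> (coords n t)))\<^sup>2)"
    using assms by (intro Bochner_Integration.integral_add fock_integrable)
  finally show "norm (norm (sector_inner l n \<Phi> \<Psi>)) \<le> (LINT t|conf n (interval l). (cmod (\<Phi> (coords n t)))\<^sup>2)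
      + (LINT t|conf n (interval l). (cmod (\<Psi> (coords n t)))\<^sup>2)" by simp
qed

lemma fock_inner_sums:
  assumes "\<Phi> \<in> fock l" "\<Psi> \<in> fock l"
  shows "(\<lambda>n. sector_inner l n \<Phi> \<Psi>) sums fock_inner l \<Phi> \<Psi>"
  using summable_norm_cancel[OF sector_inner_summable[OF assms]]
  by (simp add: fock_inner_def sector_inner_def summable_sums)

text \<open>Square integrability and summability follow from
  \<open>|c a + b|^2 <= 2 |c|^2 |a|^2 + 2 |b|^2\<close>.\<close>

lemma fock_linear_combination:
  assumes "\<Phi> \<in> fock l" "\<Psi> \<in> fock l"
  shows "(\<lambda>xs. c * \<Phi> xs + \<Psi> xs) \<in> fock l"
proof -
  let ?M = "\<lambda>n. conf n (interval l)"
  let ?b = "\<lambda>n t. 2 * (cmod c)\<^sup>2 * (cmod (\<Phi> (coords n t)))\<^sup>2 + 2 * (cmod (\<Psi> (coords n t)))\<^sup>2"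
  have bound: "(cmod (c * a + b))\<^sup>2 \<le> 2 * (cmod c)\<^sup>2 * (cmod a)\<^sup>2 + 2 * (cmod b)\<^sup>2" for a b
  proof -
    have "(cmod (c * a + b))\<^sup>2 \<le> (cmod c * cmod a + cmod b)\<^sup>2"
      using norm_triangle_ineq[of "c * a" b] by (intro power_mono) (auto simp: norm_mult)
    also have "\<dots> \<le> 2 * (cmod c * cmod a)\<^sup>2 + 2 * (cmod b)\<^sup>2"
      using zero_le_power2[of "cmod c * cmod a - cmod b"] by (simp add: power2_eq_square algebra_simps)
    finally show ?thesis by (simp add: power_mult_distrib)
  qed
  have meas [measurable]: "(\<lambda>t. \<Phi> (coords n t)) \<in> borel_measurable (?M n)"
    "(\<lambda>t. \<Psi> (coords n t)) \<in> borel_measurable (?M n)" for n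
    using assms by (auto intro: fock_measurable)
  have int_b: "integrable (?M n) (?b n)" for n
    using assms by (intro Bochner_Integration.integrable_add integrable_mult_right fock_integrable)
  have int: "integrable (?M n) (\<lambda>t. (cmod (c * \<Phi> (coords n t) + \<Psi> (coords n t)))\<^sup>2)" for n
    by (rule Bochner_Integration.integrable_bound[OF int_b[of n]])
      (use bound in \<open>auto intro!: AE_I2 order_trans[OF bound]\<close>)
  have "summable (\<lambda>n. LINT t|?M n. (cmod (c * \<Phi> (coords n t) + \<Psi> (coords n t)))\<^sup>2)"
  proof (rule summable_comparison_test'[where N = 0])
    show "summable (\<lambda>n. 2 * (cmod c)\<^sup>2 * (LINT t|?M n. (cmod (\<Phi> (coords n t)))\<^sup>2)
        + 2 * (LINT t|?M n. (cmod (\<Psi> (coords n t)))\<^sup>2))"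
      using assms by (intro summable_add summable_mult fock_summable)
    fix n
    have "(LINT t|?M n. (cmod (c * \<Phi> (coords n t) + \<Psi> (coords n t)))\<^sup>2) \<le> (LINT t|?M n. ?b n t)"
      using bound by (intro integral_mono int int_b)
    also have "\<dots> = 2 * (cmod c)\<^sup>2 * (LINT t|?M n. (cmod (\<Phi> (coords n t)))\<^sup>2)
        + 2 * (LINT t|?M n. (cmod (\<Psi> (coords n t)))\<^sup>2)"
      using fock_integrable[OF assms(1)] fock_integrable[OF assms(2)] by simp
    finally show "norm (LINT t|?M n. (cmod (c * \<Phi> (coords n t) + \<Psi> (coords n t)))\<^sup>2)
        \<le> 2 * (cmod c)\<^sup>2 * (LINT t|?M n. (cmod (\<Phi> (coords n t)))\<^sup>2)
          + 2 * (LINT t|?M n. (cmod (\<Psi> (coords n t)))\<^sup>2)" by simp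
  qed
  moreover have "c * \<Phi> xs + \<Psi> xs = c * \<Phi> ys + \<Psi> ys" if "mset xs = mset ys" for xs ys
    using fock_symmetric[OF assms(1) that] fock_symmetric[OF assms(2) that] by simp
  moreover have "(\<lambda>t. c * \<Phi> (coords n t) + \<Psi> (coords n t)) \<in> borel_measurable (?M n)" for n
    by measurable
  ultimately show ?thesis unfolding fock_def using int by blast
qed

text \<open>A concrete function of the number operator, acting on representatives everywhere. It is
  the model with which any operator given by the ansatz is compared.\<close>

definition number_phase :: "(nat \<Rightarrow> complex) \<Rightarrow> wavefun \<Rightarrow> wavefun" where
  "number_phase c \<Psi> = (\<lambda>xs. c (length xs) * \<Psi> xs)"

lemma length_coords [simp]: "length (coords n t) = n"
  by (simp add: coords_def)

lemma number_phase_fock: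
  assumes "\<And>n. cmod (c n) = 1" "\<Psi> \<in> fock l"
  shows "number_phase c \<Psi> \<in> fock l"
proof -
  have sym: "c (length xs) * \<Psi> xs = c (length ys) * \<Psi> ys" if "mset xs = mset ys" for xs ys
    using fock_symmetric[OF assms(2) that] mset_eq_length[OF that] by simp
  have norm: "cmod (c n * z) = cmod z" for n z using assms(1) by (simp add: norm_mult)
  have meas: "(\<lambda>t. c n * \<Psi> (coords n t)) \<in> borel_measurable (conf n (interval l))" for n
    using fock_measurable[OF assms(2)] by (intro borel_measurable_times) auto
  show ?thesis
    unfolding fock_def number_phase_def mem_Collect_eq length_coords norm
    using sym meas fock_integrable[OF assms(2)] fock_summable[OF assms(2)] by blast
qed

lemma sector_inner_number_phase:
  "sector_inner l n \<Phi> (number_phase c \<Psi>) = c n * sector_inner l n \<Phi> \<Psi>"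
proof -
  have "cnj a * (c n * b) = c n * (cnj a * b)" for a b by (rule mult.left_commute)
  then show ?thesis
    unfolding sector_inner_def number_phase_def length_coords by (simp only: integral_mult_right_zero)
qed

section \<open>Almost-everywhere equality and matrix elements\<close>

lemma fock_inner_cong:
  assumes "\<Phi> \<in> fock l" "\<Phi>' \<in> fock l" "\<Psi> \<in> fock l" "\<Psi>' \<in> fock l"
    and "fock_eq l \<Phi> \<Phi>'" "fock_eq l \<Psi> \<Psi>'"
  shows "fock_inner l \<Phi> \<Psi> = fock_inner l \<Phi>' \<Psi>'"
proof -
  have "sector_inner l n \<Phi> \<Psi> = sector_inner l n \<Phi>' \<Psi>'" for n
    unfolding sector_inner_def
  proof (rule integral_cong_AE)
    have "AE t in conf n (interval l). \<Phi> (coords n t) = \<Phi>' (coords n t)"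
      "AE t in conf n (interval l). \<Psi> (coords n t) = \<Psi>' (coords n t)"
      using assms(5,6) by (auto simp: fock_eq_def)
    then show "AE t in conf n (interval l). cnj (\<Phi> (coords n t)) * \<Psi> (coords n t)
        = cnj (\<Phi>' (coords n t)) * \<Psi>' (coords n t)"
      by eventually_elim simp
  qed (use assms in \<open>auto intro!: borel_measurable_integrable sector_integrable\<close>)
  then show ?thesis by (simp add: fock_inner_def sector_inner_def)
qed

lemma sector_inner_self:
  "sector_inner l n \<Phi> \<Phi> = complex_of_real (LINT t|conf n (interval l). (cmod (\<Phi> (coords n t)))\<^sup>2)"
proof -
  have "cnj z * z = complex_of_real ((cmod z)\<^sup>2)" for z
    by (metis complex_norm_square mult.commute)
  then show ?thesis unfolding sector_inner_def by (simp add: integral_complex_of_real del: of_real_power)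
qed

text \<open>Testing with the difference of the two vectors shows that its squared norm is 0. The
  sector norms are nonnegative and sum to 0, so each vanishes.\<close>

lemma fock_eq_if_inner_eq:
  assumes X: "X \<in> fock l" and Y: "Y \<in> fock l"
    and eq: "\<And>\<Phi>. \<Phi> \<in> fock l \<Longrightarrow> fock_inner l \<Phi> X = fock_inner l \<Phi> Y"
  shows "fock_eq l X Y"
proof -
  \<comment> \<open>The difference is written in the shape to which
    \<open>fock_linear_combination\<close> applies.\<close>
  define Z where "Z = (\<lambda>xs. - 1 * Y xs + X xs)"
  have Z: "Z \<in> fock l" unfolding Z_def using Y X by (rule fock_linear_combination)
  have sec: "sector_inner l n Z Z = sector_inner l n Z X - sector_inner l n Z Y" for n
  proof -
    have "sector_inner l n Z Z = (LINT t|conf n (interval l).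
        cnj (Z (coords n t)) * X (coords n t) - cnj (Z (coords n t)) * Y (coords n t))"
      unfolding sector_inner_def
      by (rule Bochner_Integration.integral_cong) (auto simp: Z_def algebra_simps)
    also have "\<dots> = sector_inner l n Z X - sector_inner l n Z Y"
      unfolding sector_inner_def by (intro Bochner_Integration.integral_diff sector_integrable X Y Z)
    finally show ?thesis .
  qed
  let ?s = "\<lambda>n. LINT t|conf n (interval l). (cmod (Z (coords n t)))\<^sup>2"
  have "(\<lambda>n. sector_inner l n Z Z) sums (fock_inner l Z X - fock_inner l Z Y)"
    unfolding sec by (intro sums_diff fock_inner_sums X Y Z)
  then have "(\<lambda>n. complex_of_real (?s n)) sums complex_of_real 0"
    unfolding sector_inner_self by (simp add: eq[OF Z])
  then have sums0: "?s sums 0" unfolding sums_of_real_iff .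
  have "?s n = 0" for n
  proof -
    have "suminf ?s = 0" using sums0 by (rule sums_unique[symmetric])
    then show ?thesis using suminf_eq_zero_iff[OF fock_summable[OF Z]] by simp
  qed
  then have "AE t in conf n (interval l). (cmod (Z (coords n t)))\<^sup>2 = 0" for n
    using integral_nonneg_eq_0_iff_AE[OF fock_integrable[OF Z, of n]] by simp
  then have "AE t in conf n (interval l). X (coords n t) = Y (coords n t)" for n
    by (rule AE_mp) (auto simp: Z_def)
  then show ?thesis by (simp add: fock_eq_def)
qed

lemma fock_eq_sym: "fock_eq l \<Phi> \<Psi> \<Longrightarrow> fock_eq l \<Psi> \<Phi>"
  by (simp add: fock_eq_def eq_commute)

lemma fock_eq_trans:
  assumes "fock_eq l \<Phi> \<Psi>" "fock_eq l \<Psi> X"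
  shows "fock_eq l \<Phi> X"
  unfolding fock_eq_def
proof
  fix n
  have "AE t in conf n (interval l). \<Phi> (coords n t) = \<Psi> (coords n t)"
    "AE t in conf n (interval l). \<Psi> (coords n t) = X (coords n t)"
    using assms by (auto simp: fock_eq_def)
  then show "AE t in conf n (interval l). \<Phi> (coords n t) = X (coords n t)"
    by eventually_elim simp
qed

lemma fock_eq_linear_combination:
  assumes "fock_eq l \<Phi> \<Phi>'" "fock_eq l \<Psi> \<Psi>'"
  shows "fock_eq l (\<lambda>xs. c * \<Phi> xs + \<Psi> xs) (\<lambda>xs. c * \<Phi>' xs + \<Psi>' xs)"
  unfolding fock_eq_def
proof
  fix n
  have "AE t in conf n (interval l). \<Phi> (coords n t) = \<Phi>' (coords n t)"
    "AE t in conf n (interval l). \<Psi> (coords n t) = \<Psi>' (coords n t)"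
    using assms by (auto simp: fock_eq_def)
  then show "AE t in conf n (interval l). c * \<Phi> (coords n t) + \<Psi> (coords n t)
      = c * \<Phi>' (coords n t) + \<Psi>' (coords n t)"
    by eventually_elim simp
qed

lemma fock_eq_number_phase:
  assumes "fock_eq l \<Phi> \<Psi>"
  shows "fock_eq l (number_phase c \<Phi>) (number_phase c \<Psi>)"
  using assms by (force simp: fock_eq_def number_phase_def elim: AE_mp)

text \<open>All clauses of unitarity are insensitive to null sets, so they transfer from
  \<open>number_phase c\<close>. There, isometry holds because the phases have modulus 1.\<close>

lemma fock_unitary_if_number_phase:
  assumes c: "\<And>n. cmod (c n) = 1"
    and U: "\<And>\<Psi>. \<Psi> \<in> fock l \<Longrightarrow> U \<Psi> \<in> fock l"
    and eq: "\<And>\<Psi>. \<Psi> \<in> fock l \<Longrightarrow> fock_eq l (U \<Psi>) (number_phase c \<Psi>)"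
  shows "fock_unitary l U"
  unfolding fock_unitary_def
proof (intro conjI ballI impI allI)
  note np = number_phase_fock[OF c]
  fix \<Phi> \<Psi> assume \<Phi>: "\<Phi> \<in> fock l" and \<Psi>: "\<Psi> \<in> fock l"
  show "U \<Psi> \<in> fock l" using \<Psi> by (rule U)
  show "fock_eq l (U \<Phi>) (U \<Psi>)" if "fock_eq l \<Phi> \<Psi>"
    by (rule fock_eq_trans[OF eq[OF \<Phi>] fock_eq_trans[OF fock_eq_number_phase[OF that]
          fock_eq_sym[OF eq[OF \<Psi>]]]])
  show "fock_eq l (U (\<lambda>xs. a * \<Phi> xs + \<Psi> xs)) (\<lambda>xs. a * U \<Phi> xs + U \<Psi> xs)" for a
  proof -
    have "number_phase c (\<lambda>xs. a * \<Phi> xs + \<Psi> xs)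
        = (\<lambda>xs. a * number_phase c \<Phi> xs + number_phase c \<Psi> xs)"
      by (auto simp: number_phase_def algebra_simps)
    then have "fock_eq l (U (\<lambda>xs. a * \<Phi> xs + \<Psi> xs))
        (\<lambda>xs. a * number_phase c \<Phi> xs + number_phase c \<Psi> xs)"
      using eq[OF fock_linear_combination[OF \<Phi> \<Psi>], of a] by simp
    then show ?thesis
      by (rule fock_eq_trans)
        (rule fock_eq_linear_combination[OF fock_eq_sym[OF eq[OF \<Phi>]] fock_eq_sym[OF eq[OF \<Psi>]]])
  qed
  have c1: "cnj (c n) * c n = 1" for n
    by (metis c complex_norm_square mult.commute of_real_1 one_power2)
  have one: "cnj (c n * a) * (c n * b) = cnj a * b" for n a b
  proof -
    have "cnj (c n * a) * (c n * b) = (cnj (c n) * c n) * (cnj a * b)" by (simp only: complex_cnj_mult mult_ac)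
    then show ?thesis by (simp only: c1 mult_1)
  qed
  have "fock_inner l (U \<Phi>) (U \<Psi>) = fock_inner l (number_phase c \<Phi>) (number_phase c \<Psi>)"
    by (intro fock_inner_cong U np eq \<Phi> \<Psi>)
  also have "\<dots> = fock_inner l \<Phi> \<Psi>"
    unfolding fock_inner_def number_phase_def by (simp only: length_coords one)
  finally show "fock_inner l (U \<Phi>) (U \<Psi>) = fock_inner l \<Phi> \<Psi>" .
  \<comment> \<open>Surjectivity: multiplication by the conjugate phases inverts
    \<open>number_phase c\<close>.\<close>
  have "number_phase c (number_phase (\<lambda>n. cnj (c n)) \<Psi>) = \<Psi>"
    unfolding number_phase_def mult.assoc[symmetric] mult.commute[of "c _"] c1 by simp
  moreover have "number_phase (\<lambda>n. cnj (c n)) \<Psi> \<in> fock l"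
    using c \<Psi> by (intro number_phase_fock) auto
  ultimately show "\<exists>\<Phi>\<in>fock l. fock_eq l (U \<Phi>) \<Psi>"
    using eq[of "number_phase (\<lambda>n. cnj (c n)) \<Psi>"]
    by (intro bexI[of _ "number_phase (\<lambda>n. cnj (c n)) \<Psi>"]) simp_all
qed

section \<open>Matrix elements of the ansatz\<close>

lemma Ad_vac_coords:
  "Ad_vac (coords j t) \<Phi> \<Psi> = fact j * (cnj (\<Phi> (coords j t)) * \<Psi> (coords j t))"
  by (simp add: Ad_vac_eq)

lemma ordered_integrable_Ad_vac:
  assumes "\<Phi> \<in> fock l" "\<Psi> \<in> fock l"
  shows "ordered_integrable (- l / 2) (l / 2) j (\<lambda>xs. Ad_vac xs \<Phi> \<Psi>)"
  unfolding ordered_integrable_def Ad_vac_coords interval_def[symmetric]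
  by (intro integrable_path_ordered_mult integrable_mult_right sector_integrable assms)

text \<open>The factor \<open>j!\<close> produced by the field operators equals the number of
  orderings of \<open>j\<close> points, so the ordered integral recovers the integral over the whole
  cube.\<close>

lemma ordered_integral_Ad_vac:
  assumes "\<Phi> \<in> fock l" "\<Psi> \<in> fock l"
  shows "ordered_integral (- l / 2) (l / 2) j (\<lambda>xs. Ad_vac xs \<Phi> \<Psi>) = sector_inner l j \<Phi> \<Psi>"
proof -
  have "sector_inner l j \<Phi> \<Psi> = fact j * (LINT t|conf j (interval l).
      complex_of_real (path_ordered j t) * (cnj (\<Phi> (coords j t)) * \<Psi> (coords j t)))"
    unfolding sector_inner_def
  proof (rule ordered_integral_symmetric)
    show "cnj (\<Phi> xs) * \<Psi> xs = cnj (\<Phi> ys) * \<Psi> ys" if "mset xs = mset ys" for xs ys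
      using fock_symmetric[OF assms(1) that] fock_symmetric[OF assms(2) that] by simp
    show "interval l \<in> sets borel" by (simp add: interval_def)
  qed (rule sector_integrable[OF assms])
  also have "\<dots> = (LINT t|conf j (interval l). complex_of_real (path_ordered j t) *
      (fact j * (cnj (\<Phi> (coords j t)) * \<Psi> (coords j t))))"
    unfolding mult.left_commute[of _ "fact j"] by (simp only: integral_mult_right_zero)
  finally show ?thesis
    by (simp only: ordered_integral_def Ad_vac_coords interval_def[symmetric])
qed

lemma generator_word_ordered:
  assumes "\<Phi> \<in> fock l" "\<Psi> \<in> fock l" "T \<in> carrier_mat n n" "a < n" "b < n"
  defines "f \<equiv> \<lambda>xs. generator_word n (\<lambda>x. 0\<^sub>m n n) (\<lambda>x. T) xs vac_proj \<Phi> \<Psi> $$ (a, b)"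
  shows "ordered_integrable (- l / 2) (l / 2) k f"
    and "ordered_integral (- l / 2) (l / 2) k f = (T ^\<^sub>m k) $$ (a, b) * sector_inner l k \<Phi> \<Psi>"
proof -
  have f: "complex_of_real (path_ordered k t) * f (coords k t)
      = (T ^\<^sub>m k) $$ (a, b) * (complex_of_real (path_ordered k t) * Ad_vac (coords k t) \<Phi> \<Psi>)" for t
    using assms by (simp add: generator_word_entry)
  note int = ordered_integrable_Ad_vac[OF assms(1,2), unfolded ordered_integrable_def]
  show "ordered_integrable (- l / 2) (l / 2) k f"
    unfolding ordered_integrable_def f by (intro integrable_mult_right int)
  show "ordered_integral (- l / 2) (l / 2) k f = (T ^\<^sub>m k) $$ (a, b) * sector_inner l k \<Phi> \<Psi>"
    unfolding ordered_integral_Ad_vac[OF assms(1,2), symmetric] ordered_integral_def f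
    by (rule integral_mult_right_zero)
qed

text \<open>Integrability of the Dyson terms is automatic for Fock vectors and each term factorises,
  so only entrywise convergence remains to be checked.\<close>

lemma has_path_exp_iff:
  assumes "\<Phi> \<in> fock l" "\<Psi> \<in> fock l" "T \<in> carrier_mat n n"
  shows "has_path_exp n (\<lambda>x. 0\<^sub>m n n) (\<lambda>x. T) (- l / 2) (l / 2) vac_proj \<Phi> \<Psi> W \<longleftrightarrow>
    W \<in> carrier_mat n n \<and>
    (\<forall>a<n. \<forall>b<n. (\<lambda>k. (T ^\<^sub>m k) $$ (a, b) * sector_inner l k \<Phi> \<Psi>) sums (W $$ (a, b)))"
proof -
  let ?f = "\<lambda>a b xs. generator_word n (\<lambda>x. 0\<^sub>m n n) (\<lambda>x. T) xs vac_proj \<Phi> \<Psi> $$ (a, b)"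
  have "(\<forall>k. ordered_integrable (- l / 2) (l / 2) k (?f a b)) \<and>
      (\<lambda>k. ordered_integral (- l / 2) (l / 2) k (?f a b)) sums (W $$ (a, b)) \<longleftrightarrow>
      (\<lambda>k. (T ^\<^sub>m k) $$ (a, b) * sector_inner l k \<Phi> \<Psi>) sums (W $$ (a, b))"
    if "a < n" "b < n" for a b
    by (simp only: generator_word_ordered[OF assms that] HOL.simp_thms)
  then show ?thesis unfolding has_path_exp_def by blast
qed

text \<open>Entries of powers of \<open>T_phase\<close> are 0 or 1, so every series is dominated by
  the absolutely convergent series of sector inner products.\<close>

lemma has_path_exp_phase_exists:
  assumes "\<Phi> \<in> fock l" "\<Psi> \<in> fock l"
  shows "\<exists>W. has_path_exp (D + 1) (\<lambda>x. 0\<^sub>m (D + 1) (D + 1)) (\<lambda>x. T_phase D) (- l / 2) (l / 2) vac_proj \<Phi> \<Psi> W"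
proof -
  let ?f = "\<lambda>a b k. (T_phase D ^\<^sub>m k) $$ (a, b) * sector_inner l k \<Phi> \<Psi>"
  have "summable (?f a b)" if "a < D + 1" "b < D + 1" for a b
    using that
    by (intro summable_comparison_test'[OF sector_inner_summable[OF assms], where N = 0])
      (auto simp: T_phase_pow norm_mult)
  then show ?thesis
    unfolding has_path_exp_iff[OF assms T_phase_carrier]
    by (intro exI[of _ "mat (D + 1) (D + 1) (\<lambda>(a, b). \<Sum>k. ?f a b k)"]) (auto simp: summable_sums)
qed

text \<open>At \<open>(0, 0)\<close> the Dyson series keeps every sector. At \<open>(1, D)\<close>
  it keeps only \<open>k = D - 1\<close>.\<close>

lemma tr_has_path_exp_phase:
  assumes "0 < D" "\<Phi> \<in> fock l" "\<Psi> \<in> fock l"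
    and W: "has_path_exp (D + 1) (\<lambda>x. 0\<^sub>m (D + 1) (D + 1)) (\<lambda>x. T_phase D) (- l / 2) (l / 2) vac_proj \<Phi> \<Psi> W"
  shows "tr (B_phase D \<theta> * W) = fock_inner l \<Phi> \<Psi> + (cis \<theta> - 1) * sector_inner l (D - 1) \<Phi> \<Psi>"
proof -
  have W: "W \<in> carrier_mat (D + 1) (D + 1)"
    and sums: "\<And>a b. a < D + 1 \<Longrightarrow> b < D + 1 \<Longrightarrow>
      (\<lambda>k. (T_phase D ^\<^sub>m k) $$ (a, b) * sector_inner l k \<Phi> \<Psi>) sums (W $$ (a, b))"
    using W unfolding has_path_exp_iff[OF assms(2,3) T_phase_carrier] by auto
  have "(\<lambda>k. sector_inner l k \<Phi> \<Psi>) sums (W $$ (0, 0))"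
    using sums[of 0 0] by (simp add: T_phase_pow)
  then have 1: "W $$ (0, 0) = fock_inner l \<Phi> \<Psi>"
    using fock_inner_sums[OF assms(2,3)] by (rule sums_unique2)
  have "(T_phase D ^\<^sub>m k) $$ (1, D) * sector_inner l k \<Phi> \<Psi>
      = (if k = D - 1 then sector_inner l k \<Phi> \<Psi> else 0)" for k
    using assms(1) by (auto simp: T_phase_pow)
  then have "(\<lambda>k. if k = D - 1 then sector_inner l k \<Phi> \<Psi> else 0) sums (W $$ (1, D))"
    using sums[of 1 D] assms(1) by simp
  then have 2: "W $$ (1, D) = sector_inner l (D - 1) \<Phi> \<Psi>"
    using sums_single[of "D - 1" "\<lambda>k. sector_inner l k \<Phi> \<Psi>"] by (rule sums_unique2)
  show ?thesis unfolding tr_B_phase_mult[OF assms(1) W] 1 2 ..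
qed

text \<open>A phase in one sector changes a single term of the series for the inner product.\<close>

lemma fock_inner_number_phase_single:
  assumes "\<And>n. cmod (c n) = 1" "\<And>n. n \<noteq> m \<Longrightarrow> c n = 1" "\<Phi> \<in> fock l" "\<Psi> \<in> fock l"
  shows "fock_inner l \<Phi> (number_phase c \<Psi>)
    = fock_inner l \<Phi> \<Psi> + (c m - 1) * sector_inner l m \<Phi> \<Psi>"
proof -
  let ?s = "\<lambda>k. sector_inner l k \<Phi> \<Psi>"
  have "(\<lambda>k. ?s k + (if k = m then (c k - 1) * ?s k else 0)) sums
      (fock_inner l \<Phi> \<Psi> + (c m - 1) * ?s m)"
    by (intro sums_add fock_inner_sums assms sums_single)
  moreover have "?s k + (if k = m then (c k - 1) * ?s k else 0) = sector_inner l k \<Phi> (number_phase c \<Psi>)" for k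
    using assms(2)[of k] by (auto simp: sector_inner_number_phase algebra_simps)
  ultimately have "(\<lambda>k. sector_inner l k \<Phi> (number_phase c \<Psi>)) sums
      (fock_inner l \<Phi> \<Psi> + (c m - 1) * ?s m)"
    by simp
  then show ?thesis
    using fock_inner_sums[OF assms(3) number_phase_fock[OF assms(1,4)]] by (rule sums_unique2[symmetric])
qed

text \<open>The ansatz prescribes only matrix elements, hence \<open>U\<close> up to null sets.
  Existence is therefore claimed separately, and the remaining properties are asserted for every
  \<open>U\<close> with these matrix elements.\<close>

theorem proposition3:
  fixes D :: nat and \<theta> l :: real
    and n :: nat and B :: "complex mat" and Q T :: "real \<Rightarrow> complex mat"
  assumes "2 \<le> D" and "0 < l"
    and "n = D + 1"
    and "B = B_phase D \<theta>"
    and "Q = (\<lambda>x. 0\<^sub>m n n)"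
    and "T = (\<lambda>x. T_phase D)"
  shows "bulk_uniform l Q T
    \<and> (\<forall>j. cmod (tr (B * T_phase D ^\<^sub>m j)) = 1)
    \<and> (\<exists>U. cmpu_operator l n B Q T U)
    \<and> (\<forall>U. cmpu_operator l n B Q T U \<longrightarrow>
          phase_cmpu l n B Q T U
        \<and> diagonal_with l U (\<lambda>xs. tr (B * T_phase D ^\<^sub>m length xs))
        \<and> (\<forall>\<Phi>\<in>fock l. \<forall>\<Psi>\<in>fock l.
             fock_inner l \<Phi> (U \<Psi>) = fock_inner l \<Phi> \<Psi>
               + (cis \<theta> - 1) * (\<Sum>j. (if j = n - 2 then 1 else 0) *
                   ordered_integral (- l / 2) (l / 2) j (\<lambda>xs. Ad_vac xs \<Phi> \<Psi>)))
        \<and> diagonal_with l U (\<lambda>xs. if length xs = n - 2 then cis \<theta> else 1)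
        \<and> (\<forall>B' Q' T'. gauge_related l n B Q T B' Q' T' \<longrightarrow> phase_cmpu l n B' Q' T' U))"
proof -
  define c where "c j = (if j = D - 1 then cis \<theta> else 1)" for j
  \<comment> \<open>The sector is counted from the bond dimension: \<open>n - 2\<close> is
    \<open>D - 1\<close> in terms of the size of the nilpotent block.\<close>
  have D: "0 < D" "n - 2 = D - 1" using assms(1,3) by auto
  have c1: "cmod (c j) = 1" for j by (simp add: c_def)
  have tr_c: "tr (B * T_phase D ^\<^sub>m j) = c j" for j
    using tr_B_T_pow[OF D(1)] by (simp add: assms(4) c_def)
  have path: "tr (B * W) = fock_inner l \<Phi> (number_phase c \<Psi>)"
    if "\<Phi> \<in> fock l" "\<Psi> \<in> fock l" "has_path_exp n Q T (- l / 2) (l / 2) vac_proj \<Phi> \<Psi> W" for \<Phi> \<Psi> W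
  proof -
    have "fock_inner l \<Phi> (number_phase c \<Psi>)
        = fock_inner l \<Phi> \<Psi> + (c (D - 1) - 1) * sector_inner l (D - 1) \<Phi> \<Psi>"
      using c1 _ that(1,2) by (rule fock_inner_number_phase_single) (simp add: c_def)
    then show ?thesis
      using tr_has_path_exp_phase[OF D(1) that(1,2), of W \<theta>] that(3) by (simp add: assms(3-6) c_def)
  qed
  have path_ex: "\<exists>W. has_path_exp n Q T (- l / 2) (l / 2) vac_proj \<Phi> \<Psi> W"
    if "\<Phi> \<in> fock l" "\<Psi> \<in> fock l" for \<Phi> \<Psi>
    using has_path_exp_phase_exists[OF that, of D] by (simp add: assms(3,5,6))
  have carriers: "B \<in> carrier_mat n n" "Q x \<in> carrier_mat n n" "T x \<in> carrier_mat n n" for x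
    using B_phase_carrier[of D \<theta>] T_phase_carrier[of D] by (simp_all add: assms(3-6))
  \<comment> \<open>The model operator serves as the witness for existence.\<close>
  have cmpu: "cmpu_operator l n B Q T (number_phase c)"
    unfolding cmpu_operator_def
  proof (intro conjI ballI)
    fix \<Phi> \<Psi> assume \<Phi>\<Psi>: "\<Phi> \<in> fock l" "\<Psi> \<in> fock l"
    from path_ex[OF this] obtain W where "has_path_exp n Q T (- l / 2) (l / 2) vac_proj \<Phi> \<Psi> W" ..
    with path[OF \<Phi>\<Psi> this]
    show "\<exists>W. has_path_exp n Q T (- l / 2) (l / 2) vac_proj \<Phi> \<Psi> W
        \<and> fock_inner l \<Phi> (number_phase c \<Psi>) = tr (B * W)" by auto
  qed (use carriers number_phase_fock[OF c1] in auto)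
  \<comment> \<open>Matrix elements against all Fock vectors determine a vector up to null sets, so
    every solution agrees with the model operator.\<close>
  have diag: "U \<Psi> \<in> fock l" "fock_eq l (U \<Psi>) (number_phase c \<Psi>)"
    if U: "cmpu_operator l n B Q T U" and \<Psi>: "\<Psi> \<in> fock l" for U \<Psi>
  proof -
    show fock: "U \<Psi> \<in> fock l" using U \<Psi> by (simp add: cmpu_operator_def)
    show "fock_eq l (U \<Psi>) (number_phase c \<Psi>)"
    proof (rule fock_eq_if_inner_eq[OF fock number_phase_fock[OF c1 \<Psi>]])
      fix \<Phi> assume \<Phi>: "\<Phi> \<in> fock l"
      obtain W where "has_path_exp n Q T (- l / 2) (l / 2) vac_proj \<Phi> \<Psi> W"
        "fock_inner l \<Phi> (U \<Psi>) = tr (B * W)"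
        using U \<Phi> \<Psi> unfolding cmpu_operator_def by blast
      then show "fock_inner l \<Phi> (U \<Psi>) = fock_inner l \<Phi> (number_phase c \<Psi>)"
        using path[OF \<Phi> \<Psi>] by simp
    qed
  qed
  have main: "phase_cmpu l n B Q T U
        \<and> diagonal_with l U (\<lambda>xs. tr (B * T_phase D ^\<^sub>m length xs))
        \<and> (\<forall>\<Phi>\<in>fock l. \<forall>\<Psi>\<in>fock l.
             fock_inner l \<Phi> (U \<Psi>) = fock_inner l \<Phi> \<Psi>
               + (cis \<theta> - 1) * (\<Sum>j. (if j = n - 2 then 1 else 0) *
                   ordered_integral (- l / 2) (l / 2) j (\<lambda>xs. Ad_vac xs \<Phi> \<Psi>)))
        \<and> diagonal_with l U (\<lambda>xs. if length xs = n - 2 then cis \<theta> else 1)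
        \<and> (\<forall>B' Q' T'. gauge_related l n B Q T B' Q' T' \<longrightarrow> phase_cmpu l n B' Q' T' U)"
    if U: "cmpu_operator l n B Q T U" for U
  proof -
    have U_diag: "diagonal_with l U (\<lambda>xs. c (length xs))"
      using diag(2)[OF U] by (simp add: diagonal_with_def number_phase_def)
    have unitary: "fock_unitary l U"
      using c1 diag[OF U] by (rule fock_unitary_if_number_phase)
    \<comment> \<open>Unitarity and diagonality concern \<open>U\<close> alone, so new matrices need
      only represent the same \<open>U\<close>.\<close>
    have phase: "phase_cmpu l n B' Q' T' U" if "cmpu_operator l n B' Q' T' U" for B' Q' T'
      unfolding phase_cmpu_def
      by (intro conjI exI[of _ "\<lambda>xs. c (length xs)"] allI that unitary U_diag c1)
    have matrix_element: "fock_inner l \<Phi> (U \<Psi>) = fock_inner l \<Phi> \<Psi>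
        + (cis \<theta> - 1) * (\<Sum>j. (if j = n - 2 then 1 else 0) *
            ordered_integral (- l / 2) (l / 2) j (\<lambda>xs. Ad_vac xs \<Phi> \<Psi>))"
      if \<Phi>: "\<Phi> \<in> fock l" and \<Psi>: "\<Psi> \<in> fock l" for \<Phi> \<Psi>
    proof -
      have "(if j = n - 2 then 1 else 0) * ordered_integral (- l / 2) (l / 2) j (\<lambda>xs. Ad_vac xs \<Phi> \<Psi>)
          = (if j = n - 2 then sector_inner l j \<Phi> \<Psi> else 0)" for j
        by (simp only: ordered_integral_Ad_vac[OF \<Phi> \<Psi>]) simp
      then have sum: "(\<Sum>j. (if j = n - 2 then 1 else 0) *
            ordered_integral (- l / 2) (l / 2) j (\<lambda>xs. Ad_vac xs \<Phi> \<Psi>)) = sector_inner l (n - 2) \<Phi> \<Psi>"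
        by (simp only: sums_unique[OF sums_single[of "n - 2" "\<lambda>j. sector_inner l j \<Phi> \<Psi>"], symmetric])
      obtain W where W: "has_path_exp n Q T (- l / 2) (l / 2) vac_proj \<Phi> \<Psi> W"
        "fock_inner l \<Phi> (U \<Psi>) = tr (B * W)"
        using U \<Phi> \<Psi> unfolding cmpu_operator_def by blast
      from W(1) have "tr (B * W) = fock_inner l \<Phi> \<Psi> + (cis \<theta> - 1) * sector_inner l (D - 1) \<Phi> \<Psi>"
        unfolding assms(3-6) by (rule tr_has_path_exp_phase[OF D(1) \<Phi> \<Psi>])
      then show ?thesis unfolding sum W(2) unfolding D(2) .
    qed
    have gauged: "cmpu_operator l n B' Q' T' U"
      if gauge: "gauge_related l n B Q T B' Q' T'" for B' Q' T'
    proof -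
      obtain g h where g: "\<forall>x\<in>interval l. g x \<in> carrier_mat n n \<and> h x \<in> carrier_mat n n \<and>
            g x * h x = 1\<^sub>m n \<and> h x * g x = 1\<^sub>m n"
        and B': "B' = g (- l / 2) * B * h (l / 2)"
        and QT: "\<forall>x\<in>interval l. Q' x \<in> carrier_mat n n \<and> T' x \<in> carrier_mat n n"
        and W': "\<forall>x\<in>interval l. \<forall>y\<in>interval l. x \<le> y \<longrightarrow>
           (\<forall>\<Phi>\<in>fock l. \<forall>\<Psi>\<in>fock l. \<forall>W.
              has_path_exp n Q T x y vac_proj \<Phi> \<Psi> W \<longrightarrow>
              has_path_exp n Q' T' x y vac_proj \<Phi> \<Psi> (g y * W * h x))"
        using gauge unfolding gauge_related_def by (elim exE conjE)
      \<comment> \<open>The gauge relation is used for the path across the whole interval, and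
        \<open>0 < l\<close> puts its endpoints in order.\<close>
      have ends: "- l / 2 \<in> interval l" "l / 2 \<in> interval l" "- l / 2 \<le> l / 2"
        using assms(2) by (auto simp: interval_def)
      have gh: "g x \<in> carrier_mat n n" "h x \<in> carrier_mat n n" "h x * g x = 1\<^sub>m n"
        if "x \<in> interval l" for x
        using g that by auto
      have "\<exists>W. has_path_exp n Q' T' (- l / 2) (l / 2) vac_proj \<Phi> \<Psi> W \<and> fock_inner l \<Phi> (U \<Psi>) = tr (B' * W)"
        if \<Phi>: "\<Phi> \<in> fock l" and \<Psi>: "\<Psi> \<in> fock l" for \<Phi> \<Psi>
      proof -
        obtain W where W: "has_path_exp n Q T (- l / 2) (l / 2) vac_proj \<Phi> \<Psi> W"
          "fock_inner l \<Phi> (U \<Psi>) = tr (B * W)"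
          using U \<Phi> \<Psi> unfolding cmpu_operator_def by blast
        have "W \<in> carrier_mat n n" using W(1) by (simp add: has_path_exp_def)
        then have "tr (B' * (g (l / 2) * W * h (- l / 2))) = tr (B * W)"
          unfolding B' by (intro tr_gauge_invariant[OF carriers(1)] gh[OF ends(1)] gh[OF ends(2)])
        moreover have "has_path_exp n Q' T' (- l / 2) (l / 2) vac_proj \<Phi> \<Psi> (g (l / 2) * W * h (- l / 2))"
          using W' ends \<Phi> \<Psi> W(1) by blast
        ultimately show ?thesis using W(2) by auto
      qed
      moreover have "B' \<in> carrier_mat n n"
        unfolding B'
          by (rule mult_carrier_mat[OF mult_carrier_mat[OF gh(1)[OF ends(1)] carriers(1)] gh(2)[OF ends(2)]])
      moreover have "\<forall>\<Psi>\<in>fock l. U \<Psi> \<in> fock l" using diag(1)[OF U] by blast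
      ultimately show ?thesis unfolding cmpu_operator_def using QT by blast
    qed
    have "(\<lambda>xs :: real list. c (length xs)) = (\<lambda>xs. if length xs = n - 2 then cis \<theta> else 1)"
      by (simp add: c_def D(2))
    then have "diagonal_with l U (\<lambda>xs. if length xs = n - 2 then cis \<theta> else 1)"
      using U_diag by simp
    then show ?thesis
      unfolding tr_c by (intro conjI ballI allI impI phase U U_diag matrix_element gauged)
  qed
  have "bulk_uniform l Q T" by (simp add: bulk_uniform_def assms(5,6))
  moreover have "\<forall>j. cmod (tr (B * T_phase D ^\<^sub>m j)) = 1" by (simp add: tr_c c1)
  ultimately show ?thesis using cmpu main by blast
qed

end
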